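(* Let $c,c_U,s>0$ be constants. Assume $\alpha,\beta\in(0,1)$, $0<\alpha+\beta<1$, $c_1\le n_1/n_2\le c_2$ for some constants $c_1,c_2>0$, $\beta<1/e$ and $B\ge2\alpha^{-2}\log(6/\beta)$. The uniform separation rate of the two-sample test $\tilde\psi_{\nu,n,2}(\alpha)$ based on error-contaminated data, with respect to the set $\mathcal F_{1,\nu}(\rho)$, satisfies $$\inf\Big\{\rho>0:\ \sup_{\nu\in\mathcal V_G(c)}\ \sup_{\substack{(\mathbb P_1,\mathbb P_2)\in\mathcal F_{1,\nu}(\rho)\\ \mathbb P^U\in\mathcal F_U(c_U,s)}}\mathrm P\{\tilde\psi_{\nu,n,2}(\alpha)=0\}\le\beta\Big\}\le c_0\,(n_1+n_2)^{-1/2}\{\log(\alpha^{-1})+\log(\beta^{-1})\},$$ where the constant $c_0>0$ only depends on $c$, $s$ and $c_U$.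
   Context: $\mathcal H$ is a real separable infinite-dimensional Hilbert space with inner product $\langle\cdot,\cdot\rangle$ and norm $\|\cdot\|$; $\mathcal P(\mathcal H)$ is the set of Borel probability measures on $\mathcal H$. For $\mathbb P\in\mathcal P(\mathcal H)$ its characteristic functional is $w\mapsto\int_{\mathcal H}e^{\mathrm i\langle w,z\rangle}\mathbb P(\mathrm dz)$; $\varphi_\nu,\varphi_1,\varphi_2,\varphi_U$ are those of $\nu,\mathbb P_1,\mathbb P_2,\mathbb P^U$. Data: $\tilde Z_j=Z_j+U_j$, $1\le j\le n_1+n_2$, where $Z_1,\dots,Z_{n_1}$ are i.i.d. with law $\mathbb P_1$, $Z_{n_1+1},\dots,Z_{n_1+n_2}$ are i.i.d. with law $\mathbb P_2$ (the two samples being independent), and $U_1,\dots,U_{n_1+n_2}$ are i.i.d. with law $\mathbb P^U$, independent of $\{Z_j\}$. For $1\le j,k\le n_1+n_2$ let $$Q_{j,k}=\frac{\mathbf 1\{1\le j,k\le n_1\}}{n_1}+\frac{\mathbf 1\{n_1+1\le j,k\le n_1+n_2\}}{n_2}-\frac1{n_1+n_2}.$$ Set $\widetilde{\operatorname{Ed}}{}_\nu^2(\widehat{\mathbb P}_1,\widehat{\mathbb P}_2)=\frac{n_1+n_2}{n_1n_2}\sum_{j,k=1}^{n_1+n_2}\varphi_\nu(\tilde Z_j-\tilde Z_k)Q_{j,k}$ and, for a permutation $\Pi$ of $(1,\dots,n_1+n_2)$, $\widetilde{\operatorname{Ed}}{}_\nu^2(\widehat{\mathbb P}_1,\widehat{\mathbb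 P}_2,\Pi)=\frac{n_1+n_2}{n_1n_2}\sum_{j,k=1}^{n_1+n_2}\varphi_\nu(\tilde Z_{\Pi(j)}-\tilde Z_{\Pi(k)})Q_{j,k}$. With $\Pi_1,\dots,\Pi_B$ i.i.d. uniform random permutations of $(1,\dots,n_1+n_2)$ independent of the data, the test (value $1$ = rejection of $\mathbb P_1=\mathbb P_2$) is $$\tilde\psi_{\nu,n,2}(\alpha)=\mathbf 1\Big\{\frac1B\sum_{b=1}^B\mathbf 1\big\{\widetilde{\operatorname{Ed}}{}_\nu^2(\widehat{\mathbb P}_1,\widehat{\mathbb P}_2,\Pi_b)<\widetilde{\operatorname{Ed}}{}_\nu^2(\widehat{\mathbb P}_1,\widehat{\mathbb P}_2)\big\}>1-\alpha\Big\}.$$ $\mathcal V_G(c)$ is the set of mean-zero Gaussian measures $\nu$ on $\mathcal H$ with non-degenerate (strictly positive definite) covariance operator $C_\nu$ such that $\operatorname{tr}(C_\nu)\le c$. Further, $$\mathcal F_{1,\nu}(\rho)=\Big\{(\mathbb P_1,\mathbb P_2)\in\mathcal P(\mathcal H)^2:\Big[\int_{\mathcal H}|\varphi_1(w)-\varphi_2(w)|\,\nu(\mathrm dw)\Big]^2\ge\rho\Big\},$$ $$\mathcal F_U(c_U,s)=\big\{\mathbb P^U\in\mathcal P(\mathcal H):|\varphi_U(w)|\ge c_U(1+\|w\|)^{-s}\text{ for all }w\in\mathcal H\big\}.$$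
   Formalization: The constant c_0 may also depend on c_1 and c_2, fixed beforehand, not only on c, s and c_U; with c_0 independent of them the claim fails, e.g. n_1=1, n_2→∞, P^U=P_2=δ_0, P_1=(δ_0+δ_a)/2. *)

theory Defs
  imports "HOL-Probability.Probability"
begin

section \<open>Probability measures on a separable Hilbert space\<close>

text \<open>
  A real separable Hilbert space is a type of sort
  \<open>{real_inner, banach, second_countable_topology}\<close>.
\<close>

definition infinite_dimensional :: "'h::real_vector itself \<Rightarrow> bool" where
  "infinite_dimensional _ \<longleftrightarrow> \<not> (\<exists>S::'h set. finite S \<and> span S = UNIV)"

definition borel_probs :: "'h::topological_space measure set" where
  "borel_probs = {P. prob_space P \<and> sets P = sets borel}"

definition char_functional :: "'h::{real_inner,second_countable_topology} measure \<Rightarrow> 'h \<Rightarrow> complex" where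
  "char_functional P w = (CLINT z|P. iexp (w \<bullet> z))"

text \<open>Normal laws on the line, including the point masses (variance zero).\<close>

definition gaussian_on_line :: "real measure \<Rightarrow> bool" where
  "gaussian_on_line N \<longleftrightarrow>
     (\<exists>m. N = return borel m) \<or> (\<exists>m \<sigma>. \<sigma> > 0 \<and> N = density lborel (normal_density m \<sigma>))"

definition gaussian_measure :: "'h::{real_inner,second_countable_topology} measure \<Rightarrow> bool" where
  "gaussian_measure \<nu> \<longleftrightarrow>
     \<nu> \<in> borel_probs \<and> (\<forall>x. gaussian_on_line (distr \<nu> borel (\<lambda>z. z \<bullet> x)))"

text \<open>
  Mean element and covariance operator are given by their defining identities in duality. For a
  Gaussian measure all integrands below are integrable, because the marginals are normal.
\<close>

definition is_mean :: "'h::{real_inner,second_countable_topology} measure \<Rightarrow> 'h \<Rightarrow> bool" where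
  "is_mean \<nu> m \<longleftrightarrow> (\<forall>x. m \<bullet> x = (LINT z|\<nu>. z \<bullet> x))"

definition is_covariance_operator ::
    "'h::{real_inner,second_countable_topology} measure \<Rightarrow> ('h \<Rightarrow> 'h) \<Rightarrow> bool" where
  "is_covariance_operator \<nu> C \<longleftrightarrow> bounded_linear C \<and>
     (\<forall>x y. C x \<bullet> y =
        (LINT z|\<nu>. (z \<bullet> x - (LINT u|\<nu>. u \<bullet> x)) * (z \<bullet> y - (LINT u|\<nu>. u \<bullet> y))))"

definition strictly_positive_definite :: "('h::real_inner \<Rightarrow> 'h) \<Rightarrow> bool" where
  "strictly_positive_definite C \<longleftrightarrow> (\<forall>x. x \<noteq> 0 \<longrightarrow> C x \<bullet> x > 0)"

text \<open>
  Orthonormal bases of an infinite-dimensional separable Hilbert space are sequences. For a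
  positive operator, the value of the trace series does not depend on the choice of the basis.
\<close>

definition orthonormal_basis :: "(nat \<Rightarrow> 'h::real_inner) \<Rightarrow> bool" where
  "orthonormal_basis e \<longleftrightarrow>
     (\<forall>i j. e i \<bullet> e j = of_bool (i = j)) \<and> closure (span (range e)) = UNIV"

definition has_trace :: "('h::real_inner \<Rightarrow> 'h) \<Rightarrow> real \<Rightarrow> bool" where
  "has_trace C t \<longleftrightarrow> (\<exists>e. orthonormal_basis e \<and> (\<lambda>i. C (e i) \<bullet> e i) sums t)"

definition V_G :: "real \<Rightarrow> 'h::{real_inner,second_countable_topology} measure set" where
  "V_G c = {\<nu>. gaussian_measure \<nu> \<and> is_mean \<nu> 0 \<and>
      (\<exists>C t. is_covariance_operator \<nu> C \<and> strictly_positive_definite C \<and> has_trace C t \<and> t \<le> c)}"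


section \<open>Alternatives and error laws\<close>

definition F1 :: "'h::{real_inner,second_countable_topology} measure \<Rightarrow> real
    \<Rightarrow> ('h measure \<times> 'h measure) set" where
  "F1 \<nu> \<rho> = {(P1, P2). P1 \<in> borel_probs \<and> P2 \<in> borel_probs \<and>
      (LINT w|\<nu>. cmod (char_functional P1 w - char_functional P2 w))\<^sup>2 \<ge> \<rho>}"

definition F_U :: "real \<Rightarrow> real \<Rightarrow> 'h::{real_inner,second_countable_topology} measure set" where
  "F_U cU s = {PU. PU \<in> borel_probs \<and>
      (\<forall>w. cmod (char_functional PU w) \<ge> cU * (1 + norm w) powr (-s))}"


section \<open>The permutation test\<close>

definition Q :: "nat \<Rightarrow> nat \<Rightarrow> nat \<Rightarrow> nat \<Rightarrow> real" where
  "Q n1 n2 j k =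
     of_bool (j \<in> {1..n1} \<and> k \<in> {1..n1}) / real n1
     + of_bool (j \<in> {n1+1..n1+n2} \<and> k \<in> {n1+1..n1+n2}) / real n2
     - 1 / real (n1 + n2)"

text \<open>
  The real part makes the statistic real-valued. The characteristic functional of a measure that is
  symmetric under \<open>z \<mapsto> - z\<close>, such as a mean-zero Gaussian measure, is real.
\<close>

definition energy_stat :: "'h::{real_inner,second_countable_topology} measure \<Rightarrow> nat \<Rightarrow> nat
    \<Rightarrow> (nat \<Rightarrow> 'h) \<Rightarrow> real" where
  "energy_stat \<nu> n1 n2 zt = real (n1 + n2) / (real n1 * real n2) *
     (\<Sum>j\<in>{1..n1+n2}. \<Sum>k\<in>{1..n1+n2}. Re (char_functional \<nu> (zt j - zt k)) * Q n1 n2 j k)"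

definition permuted_energy_stat :: "'h::{real_inner,second_countable_topology} measure \<Rightarrow> nat \<Rightarrow> nat
    \<Rightarrow> (nat \<Rightarrow> 'h) \<Rightarrow> (nat \<Rightarrow> nat) \<Rightarrow> real" where
  "permuted_energy_stat \<nu> n1 n2 zt p = energy_stat \<nu> n1 n2 (\<lambda>j. zt (p j))"

definition perm_test :: "'h::{real_inner,second_countable_topology} measure \<Rightarrow> nat \<Rightarrow> nat \<Rightarrow> nat \<Rightarrow> real
    \<Rightarrow> (nat \<Rightarrow> 'h) \<Rightarrow> (nat \<Rightarrow> nat \<Rightarrow> nat) \<Rightarrow> real" where
  "perm_test \<nu> n1 n2 B \<alpha> zt p =
     of_bool (1 / real B *
       (\<Sum>b\<in>{1..B}. of_bool (permuted_energy_stat \<nu> n1 n2 zt (p b) < energy_stat \<nu> n1 n2 zt))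
       > 1 - \<alpha>)"

text \<open>
  The joint law of \<open>(Z, U, \<Pi>)\<close>: independence of all the variables means that it is the product of
  the marginal laws, the permutations being uniform.
\<close>

definition sample_law :: "'h::topological_space measure \<Rightarrow> 'h measure \<Rightarrow> 'h measure
    \<Rightarrow> nat \<Rightarrow> nat \<Rightarrow> nat
    \<Rightarrow> ((nat \<Rightarrow> 'h) \<times> (nat \<Rightarrow> 'h) \<times> (nat \<Rightarrow> nat \<Rightarrow> nat)) measure" where
  "sample_law P1 P2 PU n1 n2 B =
     (\<Pi>\<^sub>M j\<in>{1..n1+n2}. if j \<le> n1 then P1 else P2) \<Otimes>\<^sub>M
     ((\<Pi>\<^sub>M j\<in>{1..n1+n2}. PU) \<Otimes>\<^sub>M
      (\<Pi>\<^sub>M b\<in>{1..B}. uniform_count_measure {p. p permutes {1..n1+n2}}))"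

definition acceptance_prob :: "'h::{real_inner,second_countable_topology} measure
    \<Rightarrow> 'h measure \<Rightarrow> 'h measure \<Rightarrow> 'h measure \<Rightarrow> nat \<Rightarrow> nat \<Rightarrow> nat \<Rightarrow> real \<Rightarrow> ennreal" where
  "acceptance_prob \<nu> P1 P2 PU n1 n2 B \<alpha> =
     emeasure (sample_law P1 P2 PU n1 n2 B)
       {(z, u, p) \<in> space (sample_law P1 P2 PU n1 n2 B).
          perm_test \<nu> n1 n2 B \<alpha> (\<lambda>j. z j + u j) p = 0}"

text \<open>
  The supremum is taken in \<open>ennreal\<close>, so that it is \<open>0\<close> when there is no admissible triple of laws
  (for instance when \<open>\<rho> > 4\<close> or \<open>cU > 1\<close>); the infimum is taken in \<open>ereal\<close>. The type argument
  determines the Hilbert space.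
\<close>

definition separation_rate :: "'h::{real_inner,second_countable_topology} itself
    \<Rightarrow> real \<Rightarrow> real \<Rightarrow> real \<Rightarrow> real \<Rightarrow> real \<Rightarrow> nat \<Rightarrow> nat \<Rightarrow> nat \<Rightarrow> ereal" where
  "separation_rate _ c cU s \<alpha> \<beta> n1 n2 B =
     Inf (ereal ` {\<rho>. \<rho> > 0 \<and>
       (SUP \<nu> \<in> (V_G c :: 'h measure set). SUP ((P1, P2), PU) \<in> F1 \<nu> \<rho> \<times> F_U cU s.
          acceptance_prob \<nu> P1 P2 PU n1 n2 B \<alpha>) \<le> ennreal \<beta>})"

end

theory Submission
  imports Defs
begin

text \<open>
  Put \<open>N = n1 + n2\<close> and give observation \<open>j\<close> the weight \<open>a j = 1 / n1\<close> in the first group and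
  \<open>a j = - 1 / n2\<close> in the second. After multiplication by its prefactor, the matrix \<open>Q\<close> is the rank-one
  matrix \<open>a j * a k\<close>. Hence the statistic is \<open>\<integral> |G|\<^sup>2 d\<nu>\<close>, where
  \<open>G w = (\<Sum>j. a j * exp (\<i> * (w \<bullet> x j)))\<close> is the difference of the two empirical characteristic
  functionals (\<open>energy_stat_eq_integral\<close>). Let \<open>L = ln (1 / \<alpha>) + ln (1 / \<beta>)\<close>, which is at least 1 because
  \<open>\<beta> < 1 / e\<close>. The test is compared with a deterministic threshold \<open>t\<close> of order \<open>L / sqrt N\<close>.

  Permuted statistics stay below \<open>t\<close>. For fixed data, a transposition changes the statistic by
  \<open>O(1 / N)\<close>, and the mean over all permutations is \<open>O(1 / N)\<close>. The bounded differences inequality on the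
  symmetric group (\<open>permutation_concentration\<close>) shows that at most a fraction \<open>\<alpha> / 2\<close> of the permutations
  reaches \<open>t\<close>. By Hoeffding's inequality for the \<open>B\<close> sampled permutations, data whose own statistic is
  at least \<open>t\<close> are accepted with conditional probability at most \<open>exp (- B \<alpha>\<^sup>2 / 2) \<le> \<beta> / 6\<close>
  (\<open>conditional_acceptance_le\<close>).

  The statistic itself exceeds \<open>t\<close>. If \<open>g\<close> is the difference of the characteristic functionals of the
  contaminated laws, then \<open>|G|\<^sup>2 \<ge> 2 Re (G * cnj g) - |g|\<^sup>2\<close>. After integration the right-hand side is
  affine in \<open>G\<close>: a constant plus a sum of independent bounded variables, with mean \<open>\<Delta> = \<integral> |g|\<^sup>2 d\<nu>\<close>. Hoeffding's
  inequality for this sum bounds the lower tail of the statistic (\<open>energy_stat_lower_tail\<close>).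

  It remains to bound \<open>\<Delta>\<close> below. The characteristic functional of a contaminated law is a product, and
  Cauchy-Schwarz gives
  \<open>(\<integral> |\<phi>1 - \<phi>2| d\<nu>)\<^sup>2 \<le> \<Delta> * (\<integral> (1 + norm w) powr (2 * s) d\<nu>) / cU\<^sup>2\<close> (\<open>contaminated_separation\<close>).
  The moment on the right is bounded uniformly over \<open>V_G c\<close> (\<open>V_G_polynomial_moment\<close>), because the moments
  of a Gaussian norm are controlled by the trace of the covariance.

  The constant \<open>c0\<close> is \<open>42 K C / cU\<^sup>2\<close>. Here \<open>C\<close> bounds the moment, and
  \<open>K = c2 + 2 + 1 / c1\<close> bounds \<open>N\<^sup>2 / (n1 n2)\<close>.
\<close>

section \<open>Concentration on product spaces and on the symmetric group\<close>

text \<open>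
  The coordinates of a product space are independent, because their joint law is the identity image
  of the product measure. The inequality is therefore Hoeffding's.
\<close>

lemma hoeffding_PiM_ge:
  fixes f :: "'i \<Rightarrow> 'a \<Rightarrow> real" and a b :: "'i \<Rightarrow> real"
  assumes I: "finite I" "I \<noteq> {}"
    and M: "\<And>i. i \<in> I \<Longrightarrow> prob_space (M i)"
    and f: "\<And>i. i \<in> I \<Longrightarrow> f i \<in> borel_measurable (M i)"
    and ab: "\<And>i x. i \<in> I \<Longrightarrow> x \<in> space (M i) \<Longrightarrow> f i x \<in> {a i..b i}"
    and \<epsilon>: "\<epsilon> \<ge> 0"
    and pos: "(\<Sum>i\<in>I. (b i - a i)\<^sup>2) > 0"
  shows "measure (PiM I M)
      {x \<in> space (PiM I M). (\<Sum>i\<in>I. f i (x i)) \<ge> (\<Sum>i\<in>I. integral\<^sup>L (M i) (f i)) + \<epsilon>}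
    \<le> exp (-2 * \<epsilon>\<^sup>2 / (\<Sum>i\<in>I. (b i - a i)\<^sup>2))"
proof -
  interpret prob_space "PiM I M"
    by (intro prob_space_PiM M)
  have comp: "distr (PiM I M) (M i) (\<lambda>x. x i) = M i" if "i \<in> I" for i
    using that by (intro distr_PiM_component M)
  have "indep_vars M (\<lambda>i x. x i) I"
  proof (subst indep_vars_iff_distr_eq_PiM')
    have "distr (PiM I M) (PiM I M) (\<lambda>x. \<lambda>i\<in>I. x i) = distr (PiM I M) (PiM I M) (\<lambda>x. x)"
      by (intro distr_cong) (auto simp: space_PiM PiE_restrict)
    also have "\<dots> = PiM I M"
      by simp
    also have "\<dots> = PiM I (\<lambda>i. distr (PiM I M) (M i) (\<lambda>x. x i))"
      by (intro PiM_cong) (simp_all add: comp)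
    finally show "distr (PiM I M) (PiM I M) (\<lambda>x. \<lambda>i\<in>I. x i) =
        PiM I (\<lambda>i. distr (PiM I M) (M i) (\<lambda>x. x i))" .
  qed (use I in auto)
  then have ind: "indep_vars (\<lambda>_. borel) (\<lambda>i x. f i (x i)) I"
    by (rule indep_vars_compose2) (rule f)
  interpret Hoeffding_ineq "PiM I M" I "\<lambda>i x. f i (x i)" a b
      "\<Sum>i\<in>I. expectation (\<lambda>x. f i (x i))"
  proof unfold_locales
    fix i assume i: "i \<in> I"
    show "AE x in PiM I M. f i (x i) \<in> {a i..b i}"
      using ab[OF i] i by (intro AE_I2) (auto simp: space_PiM)
  qed (use I ind in auto)
  have "expectation (\<lambda>x. f i (x i)) = integral\<^sup>L (M i) (f i)" if i: "i \<in> I" for i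
  proof -
    have "integral\<^sup>L (M i) (f i) = integral\<^sup>L (distr (PiM I M) (M i) (\<lambda>x. x i)) (f i)"
      by (simp add: comp i)
    also have "\<dots> = expectation (\<lambda>x. f i (x i))"
      using i f[OF i] by (intro integral_distr) auto
    finally show ?thesis ..
  qed
  then show ?thesis
    using Hoeffding_ineq_ge[OF \<epsilon> pos] by simp
qed

text \<open>
  Hoeffding's lemma for the uniform distribution on a finite set, with the range of the variable
  expressed by its oscillation.
\<close>

lemma uniform_mgf_le:
  fixes g :: "'a \<Rightarrow> real"
  assumes A: "finite A" "A \<noteq> {}" and l: "l > 0"
    and osc: "\<And>x y. x \<in> A \<Longrightarrow> y \<in> A \<Longrightarrow> \<bar>g x - g y\<bar> \<le> d"
  shows "(\<Sum>x\<in>A. exp (l * (g x - (\<Sum>y\<in>A. g y) / card A))) \<le> card A * exp (l\<^sup>2 * d\<^sup>2 / 8)"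
proof -
  let ?U = "uniform_count_measure A"
  define m where "m = Min (g ` A)"
  define M where "M = Max (g ` A)"
  have card: "card A > 0" using A by (simp add: card_gt_0_iff)
  interpret prob_space ?U using A by (rule prob_space_uniform_count_measure)
  have mM: "m \<in> g ` A" "M \<in> g ` A" using A by (auto simp: m_def M_def)
  have m_le: "m \<le> M" using A by (auto simp: m_def M_def intro!: Max_ge)
  have Mm: "M - m \<le> d" using mM osc by fastforce
  interpret interval_bounded_random_variable ?U g m M
    using A by unfold_locales
      (auto simp: m_def M_def space_uniform_count_measure sets_uniform_count_measure_count_space
        cong: measurable_cong_sets intro!: AE_I2)
  have "ennreal ((\<Sum>x\<in>A. exp (l * (g x - (\<Sum>y\<in>A. g y) / card A))) / card A)
      = ennreal (expectation (\<lambda>x. exp (l * (g x - expectation g))))"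
    using A by (simp add: integral_uniform_count_measure)
  also have "\<dots> = (\<integral>\<^sup>+x. ennreal (exp (l * (g x - expectation g))) \<partial>?U)"
    using A by (intro nn_integral_eq_integral[symmetric])
      (auto simp: uniform_count_measure_def integrable_point_measure_finite)
  also have "\<dots> \<le> ennreal (exp (l\<^sup>2 * (M - m)\<^sup>2 / 8))"
    by (rule Hoeffdings_lemma_nn_integral) fact
  finally have "(\<Sum>x\<in>A. exp (l * (g x - (\<Sum>y\<in>A. g y) / card A))) / card A
      \<le> exp (l\<^sup>2 * (M - m)\<^sup>2 / 8)"
    by simp
  also have "\<dots> \<le> exp (l\<^sup>2 * d\<^sup>2 / 8)"
    using Mm m_le by (simp add: mult_left_mono power_mono)
  finally show ?thesis using card by (simp add: field_simps)
qed

text \<open>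
  Conjugating a transposition by \<open>t\<close> gives a transposition. This is how the bounded difference
  property passes from \<open>f\<close> to \<open>\<lambda>q. f (t \<circ> q)\<close>.
\<close>

lemma transpose_compose_compose:
  assumes "bij t"
  shows "t \<circ> (Transposition.transpose x y \<circ> q) = Transposition.transpose (t x) (t y) \<circ> (t \<circ> q)"
  using bij_is_inj[OF assms] by (auto simp: fun_eq_iff Transposition.transpose_def inj_eq)

text \<open>
  A permutation of \<open>insert a S\<close> is uniquely \<open>transpose a b \<circ> q\<close> with \<open>b \<in> insert a S\<close> and \<open>q\<close> a permutation
  of \<open>S\<close>. Given \<open>b\<close>, the induction hypothesis controls the fluctuation in \<open>q\<close>. The conditional means
  \<open>m b\<close> differ by at most \<open>2 * c\<close>, since \<open>transpose a b \<circ> q\<close> and \<open>transpose a b' \<circ> q\<close> are both one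
  transposition away from \<open>q\<close>; Hoeffding's lemma controls the fluctuation in \<open>b\<close>. Each point of \<open>S\<close>
  contributes the factor \<open>exp (l\<^sup>2 * (2 * c)\<^sup>2 / 8)\<close>.
\<close>

lemma permutation_mgf_le:
  fixes f :: "('a \<Rightarrow> 'a) \<Rightarrow> real" and c :: real
  assumes S: "finite S" and l: "l > 0"
    and lip: "\<And>p x y. p permutes S \<Longrightarrow> x \<in> S \<Longrightarrow> y \<in> S \<Longrightarrow> \<bar>f (Transposition.transpose x y \<circ> p) - f p\<bar> \<le> c"
  shows "(\<Sum>p | p permutes S. exp (l * (f p - (\<Sum>p | p permutes S. f p) / fact (card S))))
    \<le> fact (card S) * exp (l\<^sup>2 * c\<^sup>2 * card S / 2)"
  using S lip
proof (induction S arbitrary: f rule: finite_induct)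
  case empty
  then show ?case by simp
next
  case (insert a S)
  let ?T = "\<lambda>b. Transposition.transpose a b"
  let ?n = "card S"
  define m where "m b = (\<Sum>q | q permutes S. f (?T b \<circ> q)) / fact ?n" for b
  define \<mu> where "\<mu> = (\<Sum>p | p permutes insert a S. f p) / fact (card (insert a S))"
  have cardS: "card {q. q permutes S} = fact ?n"
    using insert by (simp add: card_permutations)
  have \<mu>: "\<mu> = (\<Sum>b\<in>insert a S. m b) / card (insert a S)"
    using insert by (simp add: \<mu>_def m_def sum_over_permutations_insert
        sum_divide_distrib[symmetric])
  have sub: "q permutes insert a S" if "q permutes S" for q
    using that by (rule permutes_subset) auto
  \<comment> \<open>fluctuation in \<open>q\<close> when \<open>b\<close> is given\<close>
  have inner: "(\<Sum>q | q permutes S. exp (l * (f (?T b \<circ> q) - m b)))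
      \<le> fact ?n * exp (l\<^sup>2 * c\<^sup>2 * ?n / 2)" if b: "b \<in> insert a S" for b
    unfolding m_def
  proof (rule insert.IH)
    fix q x y assume q: "q permutes S" and xy: "x \<in> S" "y \<in> S"
    have tr: "?T b permutes insert a S"
      using b by (intro permutes_swap_id) auto
    have "\<bar>f (Transposition.transpose (?T b x) (?T b y) \<circ> (?T b \<circ> q)) - f (?T b \<circ> q)\<bar> \<le> c"
      using xy tr by (intro insert.prems permutes_compose[OF sub[OF q] tr])
        (use permutes_in_image[OF tr] in blast)+
    then show "\<bar>f (?T b \<circ> (Transposition.transpose x y \<circ> q)) - f (?T b \<circ> q)\<bar> \<le> c"
      by (subst transpose_compose_compose) (auto intro: bij_swap)
  qed
  have osc: "\<bar>m b - m b'\<bar> \<le> 2 * c" if b: "b \<in> insert a S" "b' \<in> insert a S" for b b'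
  proof -
    have "m b - m b' = (\<Sum>q | q permutes S. f (?T b \<circ> q) - f (?T b' \<circ> q)) / fact ?n"
      by (simp add: m_def sum_subtractf diff_divide_distrib)
    also have "\<bar>\<dots>\<bar> \<le> (\<Sum>q | q permutes S. 2 * c) / fact ?n"
    proof (subst abs_divide, simp only: abs_of_pos[OF fact_gt_zero],
        intro divide_right_mono order.trans[OF sum_abs] sum_mono)
      fix q assume "q \<in> {q. q permutes S}"
      then have q: "q permutes insert a S" by (auto intro: sub)
      show "\<bar>f (?T b \<circ> q) - f (?T b' \<circ> q)\<bar> \<le> 2 * c"
        using insert.prems[OF q insertI1 b(1)] insert.prems[OF q insertI1 b(2)] by linarith
    qed simp
    also have "\<dots> = 2 * c" by (simp add: cardS)
    finally show ?thesis .
  qed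
  have "(\<Sum>p | p permutes insert a S. exp (l * (f p - \<mu>)))
      = (\<Sum>b\<in>insert a S. \<Sum>q | q permutes S. exp (l * (f (?T b \<circ> q) - \<mu>)))"
    using insert by (intro sum_over_permutations_insert)
  also have "\<dots> = (\<Sum>b\<in>insert a S. exp (l * (m b - \<mu>)) *
      (\<Sum>q | q permutes S. exp (l * (f (?T b \<circ> q) - m b))))"
    by (simp add: sum_distrib_left mult_exp_exp algebra_simps)
  also have "\<dots> \<le> (\<Sum>b\<in>insert a S. exp (l * (m b - \<mu>)) * (fact ?n * exp (l\<^sup>2 * c\<^sup>2 * ?n / 2)))"
    by (intro sum_mono mult_left_mono inner) auto
  also have "\<dots> = fact ?n * exp (l\<^sup>2 * c\<^sup>2 * ?n / 2) * (\<Sum>b\<in>insert a S. exp (l * (m b - \<mu>)))"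
    by (subst sum_distrib_right[symmetric]) (simp only: mult_ac)
  also have "\<dots> \<le> fact ?n * exp (l\<^sup>2 * c\<^sup>2 * ?n / 2) * (card (insert a S) * exp (l\<^sup>2 * (2 * c)\<^sup>2 / 8))"
    unfolding \<mu> using insert.hyps osc l by (intro mult_left_mono uniform_mgf_le) auto
  also have "\<dots> = fact (card (insert a S)) * exp (l\<^sup>2 * c\<^sup>2 * card (insert a S) / 2)"
  proof -
    have "exp (l\<^sup>2 * c\<^sup>2 * card (insert a S) / 2)
        = exp (l\<^sup>2 * c\<^sup>2 * ?n / 2) * exp (l\<^sup>2 * (2 * c)\<^sup>2 / 8)"
      using insert.hyps by (simp add: mult_exp_exp field_simps)
    then show ?thesis using insert.hyps by (simp add: field_simps)
  qed
  finally show ?case by (simp add: \<mu>_def)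
qed

text \<open>
  McDiarmid's inequality on the symmetric group: the Chernoff bound applied to \<open>permutation_mgf_le\<close>.
\<close>

lemma permutation_concentration:
  fixes f :: "('a \<Rightarrow> 'a) \<Rightarrow> real" and c :: real
  assumes S: "finite S" "S \<noteq> {}" and c: "c > 0" and x: "x \<ge> 0"
    and lip: "\<And>p u v. p permutes S \<Longrightarrow> u \<in> S \<Longrightarrow> v \<in> S \<Longrightarrow> \<bar>f (Transposition.transpose u v \<circ> p) - f p\<bar> \<le> c"
  shows "card {p. p permutes S \<and> f p \<ge> (\<Sum>p | p permutes S. f p) / fact (card S) + x}
    \<le> fact (card S) * exp (- x\<^sup>2 / (2 * c\<^sup>2 * card S))"
proof (cases "x = 0")
  case True
  have "card {p. p permutes S \<and> f p \<ge> (\<Sum>p | p permutes S. f p) / fact (card S) + x}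
      \<le> card {p. p permutes S}"
    using S by (intro card_mono) (auto simp: finite_permutations)
  then show ?thesis
    using True S(1) by (simp add: card_permutations flip: of_nat_le_iff[where 'a=real])
next
  case False
  with x have x: "x > 0" by simp
  let ?n = "real (card S)"
  have n: "?n > 0" using S by (simp add: card_gt_0_iff)
  define \<mu> where "\<mu> = (\<Sum>p | p permutes S. f p) / fact (card S)"
  \<comment> \<open>the minimizer of the exponent \<open>l\<^sup>2 * c\<^sup>2 * ?n / 2 - l * x\<close>\<close>
  define l where "l = x / (c\<^sup>2 * ?n)"
  have l: "l > 0" using x c n by (simp add: l_def)
  let ?E = "{p. p permutes S \<and> f p \<ge> \<mu> + x}"
  have "real (card ?E) * exp (l * x) = (\<Sum>p\<in>?E. exp (l * x))"
    by simp
  also have "\<dots> \<le> (\<Sum>p\<in>?E. exp (l * (f p - \<mu>)))"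
    using l by (intro sum_mono) auto
  also have "\<dots> \<le> (\<Sum>p | p permutes S. exp (l * (f p - \<mu>)))"
    using S by (intro sum_mono2) (auto simp: finite_permutations)
  also have "\<dots> \<le> fact (card S) * exp (l\<^sup>2 * c\<^sup>2 * ?n / 2)"
    unfolding \<mu>_def by (rule permutation_mgf_le[OF S(1) l lip])
  finally have "real (card ?E) \<le> fact (card S) * exp (l\<^sup>2 * c\<^sup>2 * ?n / 2) / exp (l * x)"
    by (simp add: field_simps)
  also have "\<dots> = fact (card S) * exp (l\<^sup>2 * c\<^sup>2 * ?n / 2 - l * x)"
    by (simp add: exp_diff)
  also have "l\<^sup>2 * c\<^sup>2 * ?n / 2 - l * x = - x\<^sup>2 / (2 * c\<^sup>2 * ?n)"
    using c n by (simp add: l_def field_simps power2_eq_square)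
  finally show ?thesis by (simp add: \<mu>_def)
qed

section \<open>Characteristic functionals and laws of sums\<close>

lemma iexp_measurable_borel_prob:
  assumes "P \<in> borel_probs"
  shows "(\<lambda>z. iexp (w \<bullet> z)) \<in> borel_measurable P" "integrable P (\<lambda>z. iexp (w \<bullet> z))"
proof -
  have [measurable_cong]: "sets P = sets borel" and "prob_space P"
    using assms by (auto simp: borel_probs_def)
  then interpret prob_space P by simp
  have [measurable]: "(\<bullet>) w \<in> borel_measurable borel"
    by (intro borel_measurable_continuous_onI continuous_intros)
  show *: "(\<lambda>z. iexp (w \<bullet> z)) \<in> borel_measurable P" by measurable
  show "integrable P (\<lambda>z. iexp (w \<bullet> z))"
    by (rule integrable_const_bound[where B = 1]) (use * in auto)
qed

lemma norm_char_functional_le: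
  assumes "P \<in> borel_probs"
  shows "cmod (char_functional P w) \<le> 1"
proof -
  interpret prob_space P using assms by (simp add: borel_probs_def)
  have "cmod (char_functional P w) \<le> (LINT z|P. cmod (iexp (w \<bullet> z)))"
    unfolding char_functional_def by (rule integral_norm_bound)
  also have "\<dots> = 1" by (simp add: prob_space)
  finally show ?thesis .
qed

lemma char_functional_zero:
  assumes "P \<in> borel_probs"
  shows "char_functional P 0 = 1"
proof -
  interpret prob_space P using assms by (simp add: borel_probs_def)
  show ?thesis by (simp add: char_functional_def prob_space)
qed

lemma char_functional_measurable:
  assumes "P \<in> borel_probs"
  shows "char_functional P \<in> borel_measurable borel"
proof -
  have [measurable_cong]: "sets P = sets borel" and "prob_space P"
    using assms by (auto simp: borel_probs_def)
  then interpret prob_space P by simp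
  show ?thesis unfolding char_functional_def by measurable
qed

lemma Re_char_functional:
  assumes "P \<in> borel_probs"
  shows "Re (char_functional P w) = (LINT z|P. cos (w \<bullet> z))"
    and "integrable P (\<lambda>z. cos (w \<bullet> z))"
  using iexp_measurable_borel_prob[OF assms, of w]
    integrable_Re[OF iexp_measurable_borel_prob(2)[OF assms, of w]]
    integral_Re[OF iexp_measurable_borel_prob(2)[OF assms, of w]]
  by (auto simp: char_functional_def Re_exp)

definition sum_law :: "'h::{real_normed_vector,second_countable_topology} measure \<Rightarrow> 'h measure \<Rightarrow> 'h measure" where
  "sum_law P R = distr (P \<Otimes>\<^sub>M R) borel (\<lambda>(z, u). z + u)"

lemma sum_law_borel_probs:
  assumes "P \<in> borel_probs" "R \<in> borel_probs"
  shows "sum_law P R \<in> borel_probs"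
proof -
  have [measurable_cong]: "sets P = sets borel" "sets R = sets borel" and "prob_space P" "prob_space R"
    using assms by (auto simp: borel_probs_def)
  then interpret PP: prob_space P + RR: prob_space R by simp_all
  interpret pair_prob_space P R ..
  have "(\<lambda>(z, u). z + u) \<in> borel_measurable (P \<Otimes>\<^sub>M R)" by measurable
  then have "prob_space (sum_law P R)"
    unfolding sum_law_def by (rule prob_space_distr)
  then show ?thesis by (simp add: borel_probs_def sum_law_def)
qed

lemma char_functional_sum_law:
  fixes P R :: "'h::{real_inner,second_countable_topology} measure"
  assumes "P \<in> borel_probs" "R \<in> borel_probs"
  shows "char_functional (sum_law P R) w = char_functional P w * char_functional R w"
proof -
  have [measurable_cong]: "sets P = sets borel" "sets R = sets borel" and "prob_space P" "prob_space R"
    using assms by (auto simp: borel_probs_def)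
  then interpret PP: prob_space P + RR: prob_space R by simp_all
  interpret pair_prob_space P R ..
  have [measurable]: "(\<bullet>) w \<in> borel_measurable borel"
    by (intro borel_measurable_continuous_onI continuous_intros)
  have meas: "(\<lambda>(z, u). iexp (w \<bullet> (z + u))) \<in> borel_measurable (P \<Otimes>\<^sub>M R)"
    by measurable
  have int: "integrable (P \<Otimes>\<^sub>M R) (\<lambda>(z, u). iexp (w \<bullet> (z + u)))"
    by (rule integrable_const_bound[where B = 1]) (use meas in auto)
  have "char_functional (sum_law P R) w = (CLINT x|P \<Otimes>\<^sub>M R. iexp (w \<bullet> (case x of (z, u) \<Rightarrow> z + u)))"
    unfolding char_functional_def sum_law_def by (intro integral_distr) measurable
  also have "\<dots> = (CLINT x|P \<Otimes>\<^sub>M R. (case x of (z, u) \<Rightarrow> iexp (w \<bullet> (z + u))))"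
    by (intro Bochner_Integration.integral_cong) auto
  also have "\<dots> = (CLINT z|P. CLINT u|R. iexp (w \<bullet> (z + u)))"
    using integral_fst'[OF int] by simp
  also have "\<dots> = (CLINT z|P. CLINT u|R. iexp (w \<bullet> z) * iexp (w \<bullet> u))"
    by (simp add: inner_add_right distrib_left exp_add)
  also have "\<dots> = char_functional P w * char_functional R w"
    by (simp add: char_functional_def)
  finally show ?thesis .
qed

text \<open>
  Coordinatewise sums of two independent samples again form an independent sample. On a box, both
  measures are the product over the coordinates of \<open>\<integral> R i {u. z + u \<in> A i} d(P i)(z)\<close>.
\<close>

lemma distr_PiM_sum:
  fixes P R :: "'i \<Rightarrow> 'h::{real_normed_vector,second_countable_topology} measure"
  assumes I: "finite I" and P: "\<And>i. P i \<in> borel_probs" and R: "\<And>i. R i \<in> borel_probs"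
  shows "distr (PiM I P \<Otimes>\<^sub>M PiM I R) (PiM I (\<lambda>_. borel)) (\<lambda>(z, u). \<lambda>i\<in>I. z i + u i)
    = PiM I (\<lambda>i. sum_law (P i) (R i))"
proof -
  have [measurable_cong, simp]: "sets (P i) = sets borel" "sets (R i) = sets borel"
    and ps: "prob_space (P i)" "prob_space (R i)" for i
    using P R by (auto simp: borel_probs_def)
  have [simp]: "space (P i) = UNIV" "space (R i) = UNIV" for i
    using sets_eq_imp_space_eq[of "P i" borel] sets_eq_imp_space_eq[of "R i" borel] by auto
  interpret P: product_prob_space P UNIV
    by (intro product_prob_spaceI ps)
  interpret R: product_prob_space R UNIV
    by (intro product_prob_spaceI ps)
  have sps: "prob_space (sum_law (P i) (R i))" for i
    using sum_law_borel_probs[OF P R] by (auto simp: borel_probs_def)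
  interpret S: product_prob_space "\<lambda>i. sum_law (P i) (R i)" UNIV
    by (intro product_prob_spaceI sps)
  interpret PI: prob_space "PiM I P" by (intro prob_space_PiM ps)
  interpret RI: prob_space "PiM I R" by (intro prob_space_PiM ps)
  show ?thesis
  proof (rule S.PiM_eqI[OF I])
    show "sets (distr (PiM I P \<Otimes>\<^sub>M PiM I R) (PiM I (\<lambda>_. borel)) (\<lambda>(z, u). \<lambda>i\<in>I. z i + u i))
        = sets (PiM I (\<lambda>i. sum_law (P i) (R i)))"
      by (auto simp: sum_law_def intro!: sets_PiM_cong)
  next
    fix A assume A: "\<And>i. i \<in> I \<Longrightarrow> A i \<in> sets (sum_law (P i) (R i))"
    then have [measurable]: "A i \<in> sets borel" if "i \<in> I" for i
      using that by (simp add: sum_law_def)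
    let ?f = "\<lambda>(z, u). \<lambda>i\<in>I. z i + u i"
    have comp: "(\<lambda>x. fst x i + snd x i) \<in> borel_measurable (PiM I P \<Otimes>\<^sub>M PiM I R)" if i: "i \<in> I" for i
    proof -
      have z: "(\<lambda>z. z i) \<in> borel_measurable (PiM I P)" and u: "(\<lambda>u. u i) \<in> borel_measurable (PiM I R)"
        using measurable_component_singleton[OF i, of P] measurable_component_singleton[OF i, of R]
        by (simp_all cong: measurable_cong_sets)
      show ?thesis
        by (intro borel_measurable_add measurable_compose[OF measurable_fst z] measurable_compose[OF measurable_snd u])
    qed
    have f: "?f \<in> PiM I P \<Otimes>\<^sub>M PiM I R \<rightarrow>\<^sub>M PiM I (\<lambda>_. borel)"
      unfolding case_prod_unfold by (rule measurable_restrict) (rule comp)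
    have "emeasure (distr (PiM I P \<Otimes>\<^sub>M PiM I R) (PiM I (\<lambda>_. borel)) ?f) (Pi\<^sub>E I A)
        = (\<integral>\<^sup>+y. indicator (Pi\<^sub>E I A) y \<partial>distr (PiM I P \<Otimes>\<^sub>M PiM I R) (PiM I (\<lambda>_. borel)) ?f)"
      using I by (intro nn_integral_indicator[symmetric]) (auto intro!: sets_PiM_I_finite)
    also have "\<dots> = (\<integral>\<^sup>+x. indicator (Pi\<^sub>E I A) (?f x) \<partial>(PiM I P \<Otimes>\<^sub>M PiM I R))"
      using I by (intro nn_integral_distr f borel_measurable_indicator) (auto intro!: sets_PiM_I_finite)
    also have "\<dots> = (\<integral>\<^sup>+x. (\<Prod>i\<in>I. indicator (A i) (fst x i + snd x i)) \<partial>(PiM I P \<Otimes>\<^sub>M PiM I R))"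
      using I by (intro nn_integral_cong) (auto simp: indicator_def PiE_iff prod_zero_iff split: prod.splits)
    also have "\<dots> = (\<integral>\<^sup>+z. \<integral>\<^sup>+u. (\<Prod>i\<in>I. indicator (A i) (z i + u i)) \<partial>PiM I R \<partial>PiM I P)"
    proof -
      have "(\<lambda>x. \<Prod>i\<in>I. indicator (A i) (fst x i + snd x i) :: ennreal) \<in> borel_measurable (PiM I P \<Otimes>\<^sub>M PiM I R)"
        by (intro borel_measurable_prod_ennreal measurable_compose[OF comp borel_measurable_indicator])
          (simp_all add: \<open>\<And>i. i \<in> I \<Longrightarrow> A i \<in> sets borel\<close>)
      from RI.nn_integral_fst[OF this] show ?thesis by simp
    qed
    also have "\<dots> = (\<integral>\<^sup>+z. (\<Prod>i\<in>I. \<integral>\<^sup>+u. indicator (A i) (z i + u) \<partial>R i) \<partial>PiM I P)"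
      using I by (intro nn_integral_cong R.product_nn_integral_prod) measurable
    also have "\<dots> = (\<Prod>i\<in>I. \<integral>\<^sup>+z. \<integral>\<^sup>+u. indicator (A i) (z + u) \<partial>R i \<partial>P i)"
      using I by (intro P.product_nn_integral_prod) measurable
    also have "\<dots> = (\<Prod>i\<in>I. emeasure (sum_law (P i) (R i)) (A i))"
    proof (intro prod.cong refl)
      fix i assume i: "i \<in> I"
      note [measurable] = \<open>\<And>i. i \<in> I \<Longrightarrow> A i \<in> sets borel\<close>[OF i]
      have "emeasure (sum_law (P i) (R i)) (A i) = (\<integral>\<^sup>+x. indicator (A i) x \<partial>sum_law (P i) (R i))"
        using A[OF i] by simp
      also have "\<dots> = (\<integral>\<^sup>+x. indicator (A i) (case x of (z, u) \<Rightarrow> z + u) \<partial>(P i \<Otimes>\<^sub>M R i))"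
        unfolding sum_law_def by (intro nn_integral_distr) measurable
      also have "\<dots> = (\<integral>\<^sup>+z. \<integral>\<^sup>+u. indicator (A i) (z + u) \<partial>R i \<partial>P i)"
      proof -
        have plus: "(\<lambda>(z, u). z + u) \<in> borel_measurable (P i \<Otimes>\<^sub>M R i)" by measurable
        have "(\<lambda>x. indicator (A i) (case x of (z, u) \<Rightarrow> z + u) :: ennreal) \<in> borel_measurable (P i \<Otimes>\<^sub>M R i)"
          by (rule measurable_compose[OF plus borel_measurable_indicator])
            (rule \<open>\<And>i. i \<in> I \<Longrightarrow> A i \<in> sets borel\<close>[OF i])
        from sigma_finite_measure.nn_integral_fst[OF prob_space_imp_sigma_finite[OF ps(2)] this]
        show ?thesis by simp
      qed
      finally show "(\<integral>\<^sup>+z. \<integral>\<^sup>+u. indicator (A i) (z + u) \<partial>R i \<partial>P i) = emeasure (sum_law (P i) (R i)) (A i)" ..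
    qed
    finally show "emeasure (distr (PiM I P \<Otimes>\<^sub>M PiM I R) (PiM I (\<lambda>_. borel)) ?f) (Pi\<^sub>E I A)
        = (\<Prod>i\<in>I. emeasure (sum_law (P i) (R i)) (A i))" .
  qed
qed

section \<open>The statistic as a distance of empirical characteristic functionals\<close>

definition group_weight :: "nat \<Rightarrow> nat \<Rightarrow> nat \<Rightarrow> real" where
  "group_weight n1 n2 j = (if j \<le> n1 then 1 / real n1 else - 1 / real n2)"

definition ecf_diff :: "nat \<Rightarrow> nat \<Rightarrow> (nat \<Rightarrow> 'h::real_inner) \<Rightarrow> 'h \<Rightarrow> complex" where
  "ecf_diff n1 n2 x w = (\<Sum>j\<in>{1..n1+n2}. complex_of_real (group_weight n1 n2 j) * iexp (w \<bullet> x j))"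

text \<open>
  The between-group form is the square of the difference of the group means, so it has rank one. All
  later bounds rest on this identity.
\<close>

lemma Q_eq_group_weight:
  assumes "n1 \<ge> 1" "n2 \<ge> 1" "j \<in> {1..n1+n2}" "k \<in> {1..n1+n2}"
  shows "real (n1 + n2) / (real n1 * real n2) * Q n1 n2 j k = group_weight n1 n2 j * group_weight n1 n2 k"
proof -
  have "real n1 > 0" "real n2 > 0" "real n1 + real n2 \<noteq> 0" using assms by auto
  then show ?thesis
    using assms by (cases "j \<le> n1"; cases "k \<le> n1")
      (auto simp: Q_def group_weight_def field_simps add_nonneg_eq_0_iff zero_le_mult_iff)
qed

lemma energy_stat_eq_double_sum:
  assumes "n1 \<ge> 1" "n2 \<ge> 1"
  shows "energy_stat \<nu> n1 n2 x =
    (\<Sum>j\<in>{1..n1+n2}. \<Sum>k\<in>{1..n1+n2}.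
      group_weight n1 n2 j * group_weight n1 n2 k * Re (char_functional \<nu> (x j - x k)))"
  unfolding energy_stat_def sum_distrib_left
proof (intro sum.cong refl)
  fix j k assume "j \<in> {1..n1+n2}" "k \<in> {1..n1+n2}"
  then have "real (n1 + n2) / (real n1 * real n2) * Q n1 n2 j k = group_weight n1 n2 j * group_weight n1 n2 k"
    by (rule Q_eq_group_weight[OF assms])
  then show "real (n1 + n2) / (real n1 * real n2) * (Re (char_functional \<nu> (x j - x k)) * Q n1 n2 j k)
     = group_weight n1 n2 j * group_weight n1 n2 k * Re (char_functional \<nu> (x j - x k))"
    by (metis mult.assoc mult.commute)
qed

lemma sum_group_split:
  "(\<Sum>j\<in>{1..n1+n2}. f j) = (\<Sum>j\<in>{1..n1}. f j) + (\<Sum>j\<in>{n1+1..n1+n2}. f j)" for f :: "nat \<Rightarrow> 'a::comm_monoid_add"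
proof -
  have "{1..n1+n2} = {1..n1} \<union> {n1+1..n1+n2}" by auto
  then show ?thesis by (simp add: sum.union_disjoint)
qed

lemma sum_group_weight:
  assumes "n1 \<ge> 1" "n2 \<ge> 1"
  shows "(\<Sum>j\<in>{1..n1+n2}. group_weight n1 n2 j) = 0"
    and "(\<Sum>j\<in>{1..n1+n2}. \<bar>group_weight n1 n2 j\<bar>) = 2"
    and "(\<Sum>j\<in>{1..n1+n2}. (group_weight n1 n2 j)\<^sup>2) = real (n1 + n2) / (real n1 * real n2)"
  unfolding sum_group_split using assms
  by (simp_all add: group_weight_def power2_eq_square field_simps)

lemma abs_group_weight_le:
  assumes "n1 \<ge> 1" "n2 \<ge> 1"
  shows "\<bar>group_weight n1 n2 j\<bar> \<le> real (n1 + n2) / (real n1 * real n2)"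
  using assms by (auto simp: group_weight_def field_simps)

lemma norm_ecf_diff_le:
  assumes "n1 \<ge> 1" "n2 \<ge> 1"
  shows "cmod (ecf_diff n1 n2 x w) \<le> 2"
proof -
  have "cmod (ecf_diff n1 n2 x w) \<le> (\<Sum>j\<in>{1..n1+n2}. \<bar>group_weight n1 n2 j\<bar>)"
    unfolding ecf_diff_def by (intro order.trans[OF norm_sum] sum_mono) (simp add: norm_mult)
  then show ?thesis using sum_group_weight(2)[OF assms] by simp
qed

lemma ecf_diff_measurable [measurable]:
  "ecf_diff n1 n2 x \<in> borel_measurable borel" for x :: "nat \<Rightarrow> 'h::{real_inner,second_countable_topology}"
  unfolding ecf_diff_def by measurable

lemma norm_ecf_diff_squared:
  "(cmod (ecf_diff n1 n2 x w))\<^sup>2 = (\<Sum>j\<in>{1..n1+n2}. \<Sum>k\<in>{1..n1+n2}.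
      group_weight n1 n2 j * group_weight n1 n2 k * cos ((x j - x k) \<bullet> w))"
proof -
  have "Re (ecf_diff n1 n2 x w) = (\<Sum>j\<in>{1..n1+n2}. group_weight n1 n2 j * cos (w \<bullet> x j))"
    and "Im (ecf_diff n1 n2 x w) = (\<Sum>j\<in>{1..n1+n2}. group_weight n1 n2 j * sin (w \<bullet> x j))"
    by (simp_all add: ecf_diff_def Re_exp Im_exp)
  then show ?thesis
    unfolding cmod_power2 unfolding power2_eq_square
    by (simp only: sum_product sum.distrib[symmetric])
      (auto intro!: sum.cong simp: inner_diff_left cos_diff inner_commute[of _ w] algebra_simps)
qed

lemma energy_stat_eq_integral:
  assumes "n1 \<ge> 1" "n2 \<ge> 1" "\<nu> \<in> borel_probs"
  shows "energy_stat \<nu> n1 n2 x = (LINT w|\<nu>. (cmod (ecf_diff n1 n2 x w))\<^sup>2)"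
  unfolding energy_stat_eq_double_sum[OF assms(1,2)] norm_ecf_diff_squared
  using Re_char_functional[OF assms(3)]
  by simp

text \<open>
  Composing with a transposition changes at most two summands of the empirical functional, each by at
  most \<open>2 * r\<close> with \<open>r = (n1 + n2) / (n1 * n2)\<close>. Since both functionals are bounded by 2, their squared
  moduli differ by at most \<open>4 * (4 * r)\<close>.
\<close>

lemma energy_stat_swap:
  assumes n: "n1 \<ge> 1" "n2 \<ge> 1" and \<nu>: "\<nu> \<in> borel_probs"
    and p: "p permutes {1..n1+n2}"
  shows "\<bar>energy_stat \<nu> n1 n2 (\<lambda>j. x ((Transposition.transpose u v \<circ> p) j)) - energy_stat \<nu> n1 n2 (\<lambda>j. x (p j))\<bar>
    \<le> 16 * (real (n1 + n2) / (real n1 * real n2))"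
proof -
  have [measurable_cong]: "sets \<nu> = sets borel" and "prob_space \<nu>"
    using \<nu> by (auto simp: borel_probs_def)
  then interpret prob_space \<nu> by simp
  let ?r = "real (n1 + n2) / (real n1 * real n2)"
  let ?y = "\<lambda>j. x (p j)" and ?y' = "\<lambda>j. x ((Transposition.transpose u v \<circ> p) j)"
  let ?J = "{j \<in> {1..n1+n2}. p j \<in> {u, v}}"
  have "(cmod (ecf_diff n1 n2 y w))\<^sup>2 \<le> 2\<^sup>2" for y w
    by (intro power_mono norm_ecf_diff_le n norm_ge_zero)
  then have int: "integrable \<nu> (\<lambda>w. (cmod (ecf_diff n1 n2 y w))\<^sup>2)" for y
    by (intro integrable_const_bound[where B = "2\<^sup>2"] AE_I2) auto
  have card: "card ?J \<le> 2"
  proof -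
    have "card ?J = card (p ` ?J)"
      using permutes_inj_on[OF p] by (intro card_image[symmetric]) (auto intro: inj_on_subset)
    also have "\<dots> \<le> card {u, v}" by (intro card_mono) auto
    also have "\<dots> \<le> 2" by (simp add: card_insert_if)
    finally show ?thesis .
  qed
  have diff: "cmod (ecf_diff n1 n2 ?y' w - ecf_diff n1 n2 ?y w) \<le> 4 * ?r" for w
  proof -
    define h where "h j = complex_of_real (group_weight n1 n2 j) * (iexp (w \<bullet> ?y' j) - iexp (w \<bullet> ?y j))" for j
    have "ecf_diff n1 n2 ?y' w - ecf_diff n1 n2 ?y w = (\<Sum>j\<in>{1..n1+n2}. h j)"
      unfolding h_def ecf_diff_def sum_subtractf[symmetric] right_diff_distrib by (rule refl)
    also have "\<dots> = (\<Sum>j\<in>?J. h j)"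
    proof (intro sum.mono_neutral_right ballI)
      fix j assume "j \<in> {1..n1+n2} - ?J"
      then have "?y' j = ?y j" by (simp add: Transposition.transpose_def)
      then show "h j = 0"
        unfolding h_def by (simp only: diff_self mult_zero_right)
    qed auto
    finally have eq: "ecf_diff n1 n2 ?y' w - ecf_diff n1 n2 ?y w = (\<Sum>j\<in>?J. h j)" .
    have "cmod (\<Sum>j\<in>?J. h j) \<le> (\<Sum>j\<in>?J. ?r * 2)"
    proof (intro order.trans[OF norm_sum] sum_mono)
      fix j
      have "cmod (iexp (w \<bullet> ?y' j) - iexp (w \<bullet> ?y j)) \<le> cmod (iexp (w \<bullet> ?y' j)) + cmod (iexp (w \<bullet> ?y j))"
        by (rule norm_triangle_ineq4)
      also have "\<dots> = 2" by (simp only: norm_exp_i_times)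
      finally have A: "cmod (iexp (w \<bullet> ?y' j) - iexp (w \<bullet> ?y j)) \<le> 2" .
      have B: "cmod (complex_of_real (group_weight n1 n2 j)) \<le> ?r"
        using abs_group_weight_le[OF n, of j] by simp
      show "cmod (h j) \<le> ?r * 2"
        unfolding h_def norm_mult by (rule mult_mono[OF B A]) simp_all
    qed
    also have "\<dots> = real (card ?J) * (?r * 2)" by simp
    also have "\<dots> \<le> 2 * (?r * 2)" using card by (intro mult_right_mono) auto
    finally show ?thesis unfolding eq by simp
  qed
  have pt: "\<bar>(cmod (ecf_diff n1 n2 ?y' w))\<^sup>2 - (cmod (ecf_diff n1 n2 ?y w))\<^sup>2\<bar> \<le> 16 * ?r" for w
  proof -
    let ?a = "cmod (ecf_diff n1 n2 ?y' w)" and ?b = "cmod (ecf_diff n1 n2 ?y w)"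
    have "?a\<^sup>2 - ?b\<^sup>2 = (?a + ?b) * (?a - ?b)"
      by (simp only: power2_eq_square square_diff_square_factored)
    then have "\<bar>?a\<^sup>2 - ?b\<^sup>2\<bar> = (?a + ?b) * \<bar>?a - ?b\<bar>"
      by (simp only: abs_mult) simp
    also have "\<dots> \<le> (2 + 2) * (4 * ?r)"
      using norm_ecf_diff_le[OF n] order.trans[OF norm_triangle_ineq3 diff[of w]]
      by (intro mult_mono add_mono) auto
    finally show ?thesis by simp
  qed
  have eq: "energy_stat \<nu> n1 n2 ?y' - energy_stat \<nu> n1 n2 ?y =
      (LINT w|\<nu>. (cmod (ecf_diff n1 n2 ?y' w))\<^sup>2 - (cmod (ecf_diff n1 n2 ?y w))\<^sup>2)"
    unfolding energy_stat_eq_integral[OF n \<nu>]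
    by (rule Bochner_Integration.integral_diff[OF int int, symmetric])
  have "\<bar>energy_stat \<nu> n1 n2 ?y' - energy_stat \<nu> n1 n2 ?y\<bar> \<le> (LINT w|\<nu>. 16 * ?r)"
    unfolding eq
  proof (rule order.trans[OF integral_abs_bound], rule integral_mono)
    show "integrable \<nu> (\<lambda>w. \<bar>(cmod (ecf_diff n1 n2 ?y' w))\<^sup>2 - (cmod (ecf_diff n1 n2 ?y w))\<^sup>2\<bar>)"
      by (intro integrable_abs Bochner_Integration.integrable_diff int)
  qed (use pt in auto)
  also have "\<dots> = 16 * ?r" by (simp add: prob_space)
  finally show ?thesis .
qed

text \<open>
  Under a uniform permutation all off-diagonal pairs have the same expected kernel value \<open>g\<close>, while the
  diagonal has the value 1. As the weights sum to zero, the off-diagonal part of the double sum is the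
  negative of its diagonal part, and only \<open>(\<Sum>j. (a j)\<^sup>2) * (1 - g)\<close> is left.
\<close>

lemma energy_stat_permutation_mean:
  assumes n: "n1 \<ge> 1" "n2 \<ge> 1" and \<nu>: "\<nu> \<in> borel_probs"
  shows "(\<Sum>p | p permutes {1..n1+n2}. energy_stat \<nu> n1 n2 (\<lambda>j. x (p j))) / fact (n1 + n2)
    \<le> 2 * (real (n1 + n2) / (real n1 * real n2))"
proof -
  let ?N = "{1..n1+n2}"
  let ?P = "{p. p permutes ?N}"
  let ?F = "fact (n1 + n2) :: real"
  let ?a = "group_weight n1 n2"
  define g where "g j k = (\<Sum>p\<in>?P. Re (char_functional \<nu> (x (p j) - x (p k))))" for j k
  have cardP: "card ?P = fact (n1 + n2)" by (simp add: card_permutations)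
  have inv: "g (s j) (s k) = g j k" if "s permutes ?N" for s j k
    unfolding g_def
    by (subst sum_permutations_compose_right[OF that, where f = "\<lambda>p. Re (char_functional \<nu> (x (p j) - x (p k)))"]) simp
  have off: "g j k = g 1 2" if jk: "j \<in> ?N" "k \<in> ?N" "j \<noteq> k" for j k
  proof -
    \<comment> \<open>two transpositions move the pair \<open>(j, k)\<close> to \<open>(1, 2)\<close>; the second one fixes 1 because \<open>?s k \<noteq> 1\<close>\<close>
    let ?s = "Transposition.transpose j 1"
    let ?t = "Transposition.transpose (?s k) 2"
    have 2: "1 \<in> ?N" "2 \<in> ?N" using n by auto
    have s: "?s permutes ?N" using jk 2 by (intro permutes_swap_id) auto
    then have "?s k \<in> ?N" using jk by (simp only: permutes_in_image)
    then have t: "?t permutes ?N" using 2 by (intro permutes_swap_id) auto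
    have "g j k = g (?s j) (?s k)" using inv[OF s, of j k] by (rule sym)
    also have "\<dots> = g (?t (?s j)) (?t (?s k))" using inv[OF t, of "?s j" "?s k"] by (rule sym)
    also have "?t (?s j) = 1"
      using jk by (auto simp: Transposition.transpose_def)
    also have "?t (?s k) = 2" by simp
    finally show ?thesis .
  qed
  have diag: "g j j = ?F" for j
    using cardP by (simp add: g_def char_functional_zero[OF \<nu>])
  have g_ge: "g 1 2 \<ge> - ?F"
  proof -
    have "(\<Sum>p\<in>?P. - 1) \<le> g 1 2"
      unfolding g_def
    proof (intro sum_mono)
      fix p
      show "- 1 \<le> Re (char_functional \<nu> (x (p 1) - x (p 2)))"
        using abs_le_D2[OF order.trans[OF abs_Re_le_cmod norm_char_functional_le[OF \<nu>]]]
        by (simp only: minus_le_iff)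
    qed
    then show ?thesis using cardP by simp
  qed
  have "(\<Sum>p\<in>?P. energy_stat \<nu> n1 n2 (\<lambda>j. x (p j))) = (\<Sum>j\<in>?N. \<Sum>k\<in>?N. ?a j * ?a k * g j k)"
    unfolding energy_stat_eq_double_sum[OF n] g_def sum_distrib_left
    by (subst sum.swap, rule sum.cong[OF refl], rule sum.swap)
  also have "\<dots> = (\<Sum>j\<in>?N. \<Sum>k\<in>?N. ?a j * ?a k * g 1 2 + (if j = k then (?a j)\<^sup>2 * (?F - g 1 2) else 0))"
  proof (intro sum.cong refl)
    fix j k assume jk: "j \<in> ?N" "k \<in> ?N"
    show "?a j * ?a k * g j k = ?a j * ?a k * g 1 2 + (if j = k then (?a j)\<^sup>2 * (?F - g 1 2) else 0)"
    proof (cases "j = k")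
      case True
      then show ?thesis by (simp add: diag power2_eq_square right_diff_distrib)
    next
      case False
      then show ?thesis by (simp only: off[OF jk False] if_False add_0_right)
    qed
  qed
  also have "\<dots> = (\<Sum>j\<in>?N. \<Sum>k\<in>?N. ?a j * ?a k * g 1 2) + (\<Sum>j\<in>?N. (?a j)\<^sup>2 * (?F - g 1 2))"
    by (simp add: sum.distrib)
  also have "(\<Sum>j\<in>?N. \<Sum>k\<in>?N. ?a j * ?a k * g 1 2) = (\<Sum>j\<in>?N. ?a j) * (\<Sum>k\<in>?N. ?a k) * g 1 2"
    unfolding sum_product unfolding sum_distrib_right by (rule refl)
  also have "\<dots> = 0" by (simp only: sum_group_weight(1)[OF n])
  also have "0 + (\<Sum>j\<in>?N. (?a j)\<^sup>2 * (?F - g 1 2)) = real (n1 + n2) / (real n1 * real n2) * (?F - g 1 2)"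
    by (simp only: sum_distrib_right[symmetric] sum_group_weight(3)[OF n])
  also have "\<dots> \<le> real (n1 + n2) / (real n1 * real n2) * (2 * ?F)"
    using g_ge by (intro mult_left_mono) auto
  finally show ?thesis by (simp only: pos_divide_le_eq[OF fact_gt_zero] mult_ac)
qed

section \<open>Lower tail of the statistic\<close>

text \<open>
  Linearization: \<open>|G|\<^sup>2 \<ge> 2 Re (G * cnj g) - |g|\<^sup>2\<close>, where \<open>g\<close> is the difference of the characteristic
  functionals. The integral of \<open>Re (G * cnj g)\<close> is \<open>\<Sum>j. a j * h (x j)\<close> with the bounded function
  \<open>h x = \<integral> Re (exp (\<i> * (w \<bullet> x)) * cnj (g w)) d\<nu>\<close>. By Fubini its mean is \<open>\<integral> |g|\<^sup>2 d\<nu>\<close>, so a lower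
  deviation by \<open>\<epsilon>\<close> of the sum becomes one by \<open>2 * \<epsilon>\<close> of the statistic. The event is enclosed in the
  measurable set \<open>E\<close> that is defined by the sum.
\<close>

lemma energy_stat_lower_tail:
  fixes \<nu> D1 D2 :: "'h::{real_inner,second_countable_topology} measure"
  assumes n: "n1 \<ge> 1" "n2 \<ge> 1" and \<nu>: "\<nu> \<in> borel_probs"
    and D: "D1 \<in> borel_probs" "D2 \<in> borel_probs" and \<epsilon>: "\<epsilon> \<ge> 0"
    and t: "t \<le> (LINT w|\<nu>. (cmod (char_functional D1 w - char_functional D2 w))\<^sup>2) - 2 * \<epsilon>"
  defines "M \<equiv> PiM {1..n1+n2} (\<lambda>j. if j \<le> n1 then D1 else D2)"
  shows "\<exists>E \<in> sets M. {x \<in> space M. energy_stat \<nu> n1 n2 x < t} \<subseteq> E \<and>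
    measure M E \<le> exp (- \<epsilon>\<^sup>2 / (8 * (real (n1 + n2) / (real n1 * real n2))))"
proof -
  let ?r = "real (n1 + n2) / (real n1 * real n2)"
  let ?N = "{1..n1+n2}" and ?a = "group_weight n1 n2"
  define D where "D j = (if j \<le> n1 then D1 else D2)" for j
  have Dj: "D j \<in> borel_probs" for j using D by (simp add: D_def)
  have [measurable_cong]: "sets \<nu> = sets borel" and "prob_space \<nu>"
    using \<nu> by (auto simp: borel_probs_def)
  then interpret prob_space \<nu> by simp
  have [measurable]: "char_functional D1 \<in> borel_measurable borel" "char_functional D2 \<in> borel_measurable borel"
    by (rule char_functional_measurable[OF D(1)], rule char_functional_measurable[OF D(2)])
  have inner_meas [measurable]: "(\<bullet>) x \<in> borel_measurable borel" for x :: 'h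
    by (intro borel_measurable_continuous_onI continuous_intros)
  have [measurable]: "cnj \<in> borel_measurable borel"
    by (intro borel_measurable_continuous_onI continuous_intros)
  define g where "g w = char_functional D1 w - char_functional D2 w" for w
  have g_meas [measurable]: "g \<in> borel_measurable borel"
    unfolding g_def by measurable
  have g_le: "cmod (g w) \<le> 2" for w
    using norm_triangle_ineq4[of "char_functional D1 w" "char_functional D2 w"]
      norm_char_functional_le[OF D(1), of w] norm_char_functional_le[OF D(2), of w]
    by (simp add: g_def)
  define k where "k w x = Re (iexp (w \<bullet> x) * cnj (g w))" for w x
  have k_le: "\<bar>k w x\<bar> \<le> 2" for w x
    using abs_Re_le_cmod[of "iexp (w \<bullet> x) * cnj (g w)"] g_le[of w]
    by (simp add: k_def norm_mult)
  have k_meas: "(\<lambda>(w, x). k w x) \<in> borel_measurable (borel \<Otimes>\<^sub>M borel)"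
    unfolding k_def by measurable
  have k_meas1: "(\<lambda>w. k w x) \<in> borel_measurable \<nu>" for x
    using measurable_compose[OF measurable_Pair2'[of x borel borel] k_meas] by (simp cong: measurable_cong_sets)
  have k_int: "integrable \<nu> (\<lambda>w. k w x)" for x
    by (rule integrable_const_bound[where B = 2]) (use k_le k_meas1 in auto)
  define h where "h x = (LINT w|\<nu>. k w x)" for x
  have h_meas: "h \<in> borel_measurable borel"
  proof -
    have "(\<lambda>(x, w). k w x) \<in> borel_measurable (borel \<Otimes>\<^sub>M \<nu>)"
      unfolding k_def by measurable
    then show ?thesis unfolding h_def by (rule borel_measurable_lebesgue_integral)
  qed
  have h_le: "\<bar>h x\<bar> \<le> 2" for x
  proof -
    have "\<bar>h x\<bar> \<le> (LINT w|\<nu>. 2)"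
      unfolding h_def by (rule order.trans[OF integral_abs_bound], rule integral_mono)
        (use k_int k_le in auto)
    then show ?thesis by (simp add: prob_space)
  qed
  have h_mean: "(LINT x|P. h x) = (LINT w|\<nu>. Re (char_functional P w * cnj (g w)))" if P: "P \<in> borel_probs" for P
  proof -
    have [measurable_cong]: "sets P = sets borel" and "prob_space P"
      using P by (auto simp: borel_probs_def)
    then interpret P: prob_space P by simp
    interpret VP: pair_prob_space \<nu> P ..
    have "(\<lambda>(w, x). k w x) \<in> borel_measurable (\<nu> \<Otimes>\<^sub>M P)"
      using k_meas by (simp cong: measurable_cong_sets add: sets_pair_measure_cong[OF \<open>sets \<nu> = sets borel\<close> \<open>sets P = sets borel\<close>])
    then have int: "integrable (\<nu> \<Otimes>\<^sub>M P) (\<lambda>(w, x). k w x)"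
      by (intro VP.integrable_const_bound[where B = 2]) (use k_le in auto)
    have "(LINT x|P. h x) = (LINT w|\<nu>. LINT x|P. k w x)"
      unfolding h_def by (rule VP.Fubini_integral[OF int])
    also have "\<dots> = (LINT w|\<nu>. Re (char_functional P w * cnj (g w)))"
    proof (intro Bochner_Integration.integral_cong refl)
      fix w
      have "integrable P (\<lambda>x. iexp (w \<bullet> x) * cnj (g w))"
        using iexp_measurable_borel_prob[OF P, of w] by simp
      from integral_Re[OF this] show "(LINT x|P. k w x) = Re (char_functional P w * cnj (g w))"
        by (simp add: k_def char_functional_def)
    qed
    finally show ?thesis .
  qed
  define \<Delta> where "\<Delta> = (LINT w|\<nu>. (cmod (g w))\<^sup>2)"
  have g2_int: "integrable \<nu> (\<lambda>w. (cmod (g w))\<^sup>2)"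
  proof (rule integrable_const_bound[where B = "2\<^sup>2"])
    show "AE w in \<nu>. norm ((cmod (g w))\<^sup>2) \<le> 2\<^sup>2"
      using power_mono[OF g_le norm_ge_zero, of _ 2] by (intro AE_I2) simp
  qed measurable
  have Re_int: "integrable \<nu> (\<lambda>w. Re (char_functional P w * cnj (g w)))" if P: "P \<in> borel_probs" for P
  proof (rule integrable_const_bound[where B = 2])
    show "(\<lambda>w. Re (char_functional P w * cnj (g w))) \<in> borel_measurable \<nu>"
      using char_functional_measurable[OF P] by measurable
    have "\<bar>Re (char_functional P w * cnj (g w))\<bar> \<le> 1 * 2" for w
    proof (rule order.trans[OF abs_Re_le_cmod])
      show "cmod (char_functional P w * cnj (g w)) \<le> 1 * 2"
        unfolding norm_mult using norm_char_functional_le[OF P, of w] g_le[of w]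
        by (intro mult_mono) auto
    qed
    then show "AE w in \<nu>. norm (Re (char_functional P w * cnj (g w))) \<le> 2" by auto
  qed
  have mean: "(\<Sum>j\<in>?N. LINT x|D j. ?a j * h x) = \<Delta>"
  proof -
    have "(\<Sum>j\<in>?N. LINT x|D j. ?a j * h x) = (\<Sum>j\<in>?N. ?a j * (LINT x|D j. h x))"
      by simp
    also have "\<dots> = (LINT x|D1. h x) - (LINT x|D2. h x)"
      unfolding sum_group_split using n by (simp add: D_def group_weight_def)
    also have "\<dots> = (LINT w|\<nu>. Re (char_functional D1 w * cnj (g w)) - Re (char_functional D2 w * cnj (g w)))"
      unfolding h_mean[OF D(1)] h_mean[OF D(2)]
      by (rule Bochner_Integration.integral_diff[OF Re_int[OF D(1)] Re_int[OF D(2)], symmetric])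
    also have "\<dots> = \<Delta>"
      unfolding \<Delta>_def
    proof (intro Bochner_Integration.integral_cong refl)
      fix w
      have "Re (char_functional D1 w * cnj (g w)) - Re (char_functional D2 w * cnj (g w)) = Re (g w * cnj (g w))"
        by (simp add: g_def left_diff_distrib)
      then show "Re (char_functional D1 w * cnj (g w)) - Re (char_functional D2 w * cnj (g w)) = (cmod (g w))\<^sup>2"
        by (simp add: complex_mult_cnj cmod_power2)
    qed
    finally show ?thesis .
  qed
  have lower: "energy_stat \<nu> n1 n2 x \<ge> 2 * (\<Sum>j\<in>?N. ?a j * h (x j)) - \<Delta>" for x
  proof -
    have G_int: "integrable \<nu> (\<lambda>w. (cmod (ecf_diff n1 n2 x w))\<^sup>2)"
    proof (rule integrable_const_bound[where B = "2\<^sup>2"])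
      show "AE w in \<nu>. norm ((cmod (ecf_diff n1 n2 x w))\<^sup>2) \<le> 2\<^sup>2"
        using power_mono[OF norm_ecf_diff_le[OF n] norm_ge_zero, of x _ 2] by (intro AE_I2) simp
    qed measurable
    have "2 * (\<Sum>j\<in>?N. ?a j * h (x j)) - \<Delta> = (LINT w|\<nu>. 2 * (\<Sum>j\<in>?N. ?a j * k w (x j)) - (cmod (g w))\<^sup>2)"
      unfolding h_def \<Delta>_def using k_int g2_int by simp
    also have "\<dots> \<le> (LINT w|\<nu>. (cmod (ecf_diff n1 n2 x w))\<^sup>2)"
    proof (rule integral_mono)
      show "integrable \<nu> (\<lambda>w. 2 * (\<Sum>j\<in>?N. ?a j * k w (x j)) - (cmod (g w))\<^sup>2)"
        using k_int g2_int by simp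
      fix w
      let ?G = "ecf_diff n1 n2 x w"
      have "(\<Sum>j\<in>?N. ?a j * k w (x j)) = Re (?G * cnj (g w))"
        by (simp add: k_def ecf_diff_def sum_distrib_right sum_distrib_left mult.assoc del: complex_cnj_mult)
      moreover have "0 \<le> (cmod (?G - g w))\<^sup>2" by simp
      moreover have "(cmod (?G - g w))\<^sup>2 = (cmod ?G)\<^sup>2 - 2 * Re (?G * cnj (g w)) + (cmod (g w))\<^sup>2"
        unfolding cmod_power2 by (simp add: power2_eq_square algebra_simps)
      ultimately show "2 * (\<Sum>j\<in>?N. ?a j * k w (x j)) - (cmod (g w))\<^sup>2 \<le> (cmod ?G)\<^sup>2"
        by linarith
    qed (rule G_int)
    finally show ?thesis unfolding energy_stat_eq_integral[OF n \<nu>] .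
  qed
  have M_eq: "M = PiM ?N D" by (simp add: M_def D_def[abs_def])
  \<comment> \<open>the sign turns the upper tail bound into the required lower one\<close>
  let ?f = "\<lambda>j y. - (?a j * h y)"
  define E where "E = {x \<in> space M. (\<Sum>j\<in>?N. ?f j (x j)) \<ge> (\<Sum>j\<in>?N. integral\<^sup>L (D j) (?f j)) + \<epsilon>}"
  have sets_D [measurable_cong]: "sets (D j) = sets borel" for j using Dj by (simp add: borel_probs_def)
  have f_meas: "?f j \<in> borel_measurable (D j)" for j
    using h_meas by measurable
  have "E \<in> sets M"
  proof -
    have "(\<lambda>x. \<Sum>j\<in>?N. ?f j (x j)) \<in> borel_measurable M"
      unfolding M_eq
    proof (rule borel_measurable_sum)
      fix j assume j: "j \<in> ?N"
      show "(\<lambda>x. ?f j (x j)) \<in> borel_measurable (PiM ?N D)"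
        by (rule measurable_PiM_component_rev[where M = D and f = "?f j", OF j f_meas])
    qed
    then show ?thesis unfolding E_def by measurable
  qed
  moreover have "{x \<in> space M. energy_stat \<nu> n1 n2 x < t} \<subseteq> E"
  proof
    fix x assume x: "x \<in> {x \<in> space M. energy_stat \<nu> n1 n2 x < t}"
    have "(\<Sum>j\<in>?N. integral\<^sup>L (D j) (?f j)) = - \<Delta>"
      using mean by (simp add: sum_negf)
    moreover have "(\<Sum>j\<in>?N. ?f j (x j)) = - (\<Sum>j\<in>?N. ?a j * h (x j))" by (simp add: sum_negf)
    moreover have "t \<le> \<Delta> - 2 * \<epsilon>" using t by (simp add: \<Delta>_def g_def)
    ultimately show "x \<in> E"
      using x lower[of x] by (simp add: E_def)
  qed
  moreover have "measure M E \<le> exp (- \<epsilon>\<^sup>2 / (8 * ?r))"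
  proof -
    let ?b = "\<lambda>j. 2 * \<bar>?a j\<bar>"
    have "(\<Sum>j\<in>?N. (?b j - (- ?b j))\<^sup>2) = (\<Sum>j\<in>?N. 16 * (?a j)\<^sup>2)"
      by (intro sum.cong refl) (simp add: power2_eq_square)
    also have "\<dots> = 16 * ?r"
      by (simp only: sum_distrib_left[symmetric] sum_group_weight(3)[OF n])
    finally have s: "(\<Sum>j\<in>?N. (?b j - (- ?b j))\<^sup>2) = 16 * ?r" .
    have r: "?r > 0" using n by simp
    have "measure M E \<le> exp (-2 * \<epsilon>\<^sup>2 / (\<Sum>j\<in>?N. (?b j - (- ?b j))\<^sup>2))"
      unfolding E_def M_eq
    proof (rule hoeffding_PiM_ge)
      show "prob_space (D j)" for j using Dj by (simp add: borel_probs_def)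
      show "?f j \<in> borel_measurable (D j)" for j by (rule f_meas)
      show "?f j y \<in> {- ?b j..?b j}" for j y
        using mult_left_mono[OF h_le, of "\<bar>?a j\<bar>" y] by (auto simp: abs_mult[symmetric] abs_le_iff mult.commute)
      show "(\<Sum>j\<in>?N. (?b j - (- ?b j))\<^sup>2) > 0"
        unfolding s by (rule mult_pos_pos[OF _ r]) simp
    qed (use n \<epsilon> in auto)
    also have "-2 * \<epsilon>\<^sup>2 / (\<Sum>j\<in>?N. (?b j - (- ?b j))\<^sup>2) = - \<epsilon>\<^sup>2 / (8 * ?r)"
    proof -
      have "-2 * \<epsilon>\<^sup>2 / (16 * q) = - \<epsilon>\<^sup>2 / (8 * q)" if "q > 0" for q :: real
        using that by (simp add: field_simps)
      from this[OF r] show ?thesis unfolding s .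
    qed
    finally show ?thesis .
  qed
  ultimately show ?thesis by blast
qed

section \<open>Acceptance probability of the permutation test\<close>

text \<open>
  Concentration around the permutation mean, which is at most \<open>2 * (n1 + n2) / (n1 * n2)\<close>.
\<close>

lemma permuted_energy_stat_tail:
  assumes n: "n1 \<ge> 1" "n2 \<ge> 1" and \<nu>: "\<nu> \<in> borel_probs" and y: "y \<ge> 0"
    and t: "t \<ge> 2 * (real (n1 + n2) / (real n1 * real n2)) + y"
  shows "real (card {p. p permutes {1..n1+n2} \<and> permuted_energy_stat \<nu> n1 n2 x p \<ge> t})
    \<le> fact (n1 + n2) * exp (- y\<^sup>2 / (2 * (16 * (real (n1 + n2) / (real n1 * real n2)))\<^sup>2 * real (n1 + n2)))"
proof -
  let ?r = "real (n1 + n2) / (real n1 * real n2)" and ?N = "{1..n1+n2}"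
  define f where "f p = energy_stat \<nu> n1 n2 (\<lambda>j. x (p j))" for p
  have "card {p. p permutes ?N \<and> permuted_energy_stat \<nu> n1 n2 x p \<ge> t}
      \<le> card {p. p permutes ?N \<and> f p \<ge> (\<Sum>p | p permutes ?N. f p) / fact (card ?N) + y}"
  proof (rule card_mono)
    show "finite {p. p permutes ?N \<and> f p \<ge> (\<Sum>p | p permutes ?N. f p) / fact (card ?N) + y}"
      by (rule finite_subset[of _ "{p. p permutes ?N}"]) (auto simp: finite_permutations)
    show "{p. p permutes ?N \<and> permuted_energy_stat \<nu> n1 n2 x p \<ge> t}
        \<subseteq> {p. p permutes ?N \<and> f p \<ge> (\<Sum>p | p permutes ?N. f p) / fact (card ?N) + y}"
      using energy_stat_permutation_mean[OF n \<nu>, of x] t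
      by (auto simp: f_def permuted_energy_stat_def)
  qed
  also have "real (card {p. p permutes ?N \<and> f p \<ge> (\<Sum>p | p permutes ?N. f p) / fact (card ?N) + y})
      \<le> fact (card ?N) * exp (- y\<^sup>2 / (2 * (16 * ?r)\<^sup>2 * card ?N))"
  proof (rule permutation_concentration)
    show "16 * ?r > 0" using n by simp
    show "\<bar>f (Transposition.transpose u v \<circ> p) - f p\<bar> \<le> 16 * ?r" if "p permutes ?N" for p u v
      unfolding f_def by (rule energy_stat_swap[OF n \<nu> that])
  qed (use n y in auto)
  finally show ?thesis by simp
qed

lemma energy_stat_cong:
  assumes "\<And>j. j \<in> {1..n1+n2} \<Longrightarrow> x j = y j"
  shows "energy_stat \<nu> n1 n2 x = energy_stat \<nu> n1 n2 y"
  unfolding energy_stat_def using assms by simp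

text \<open>
  Acceptance means that at least \<open>\<alpha> * B\<close> of the sampled permutations do not fall below the unpermuted
  statistic, hence reach \<open>t\<close>. The expected number of those that reach \<open>t\<close> is at most \<open>\<alpha> * B / 2\<close>, and
  Hoeffding's inequality bounds the excess.
\<close>

lemma conditional_acceptance_le:
  assumes B: "B \<ge> 1" and \<alpha>: "\<alpha> \<ge> 0"
    and t: "energy_stat \<nu> n1 n2 x \<ge> t"
    and card: "real (card {p. p permutes {1..n1+n2} \<and> permuted_energy_stat \<nu> n1 n2 x p \<ge> t}) \<le> fact (n1 + n2) * (\<alpha> / 2)"
  defines "M \<equiv> PiM {1..B} (\<lambda>b. uniform_count_measure {p. p permutes {1..n1+n2}})"
  shows "emeasure M {p \<in> space M. perm_test \<nu> n1 n2 B \<alpha> x p = 0} \<le> ennreal (exp (- real B * \<alpha>\<^sup>2 / 2))"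
proof -
  let ?P = "{p. p permutes {1..n1+n2}}" and ?I = "{1..B}"
  let ?U = "uniform_count_measure ?P"
  have fin: "finite ?P" by (simp add: finite_permutations)
  have ne: "?P \<noteq> {}" using permutes_id by blast
  have cardP: "card ?P = fact (n1 + n2)" by (simp add: card_permutations)
  have PU: "prob_space ?U" by (rule prob_space_uniform_count_measure[OF fin ne])
  define f :: "(nat \<Rightarrow> nat) \<Rightarrow> real" where "f q = of_bool (permuted_energy_stat \<nu> n1 n2 x q \<ge> t)" for q
  have f_meas: "f \<in> borel_measurable ?U"
    by (simp add: sets_uniform_count_measure_count_space cong: measurable_cong_sets)
  define m where "m = integral\<^sup>L ?U f"
  have "(\<Sum>q\<in>?P. f q) = real (card {p. p permutes {1..n1+n2} \<and> permuted_energy_stat \<nu> n1 n2 x p \<ge> t})"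
    using fin by (simp add: f_def sum_of_bool_eq of_bool_def sum.If_cases Int_def)
  moreover have "m = (\<Sum>q\<in>?P. f q) / fact (n1 + n2)"
    unfolding m_def by (subst integral_uniform_count_measure[OF fin]) (simp only: cardP of_nat_fact)
  ultimately have m: "m \<le> \<alpha> / 2"
    using card by (simp add: divide_le_eq mult.commute)
  define E where "E = {p \<in> space M. (\<Sum>b\<in>?I. f (p b)) \<ge> (\<Sum>b\<in>?I. m) + real B * (\<alpha> / 2)}"
  interpret prob_space M unfolding M_def by (intro prob_space_PiM PU)
  have "{p \<in> space M. perm_test \<nu> n1 n2 B \<alpha> x p = 0} \<subseteq> E"
  proof
    fix p assume p: "p \<in> {p \<in> space M. perm_test \<nu> n1 n2 B \<alpha> x p = 0}"
    let ?S = "\<Sum>b\<in>?I. of_bool (permuted_energy_stat \<nu> n1 n2 x (p b) < energy_stat \<nu> n1 n2 x) :: real"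
    have "1 / real B * ?S \<le> 1 - \<alpha>"
      using p by (simp add: perm_test_def not_less)
    then have "?S \<le> (1 - \<alpha>) * real B" using B by (simp add: field_simps)
    moreover have "(\<Sum>b\<in>?I. 1 :: real) \<le> ?S + (\<Sum>b\<in>?I. f (p b))"
      unfolding sum.distrib[symmetric] using t by (intro sum_mono) (auto simp: f_def)
    moreover have "(\<Sum>b\<in>?I. m) + real B * (\<alpha> / 2) \<le> real B * \<alpha>"
      using mult_left_mono[OF m, of "real B"] by simp
    ultimately have "(\<Sum>b\<in>?I. f (p b)) \<ge> (\<Sum>b\<in>?I. m) + real B * (\<alpha> / 2)"
      by (simp add: algebra_simps)
    with p show "p \<in> E" by (simp add: E_def)
  qed
  moreover have "E \<in> sets M"
  proof -
    have "(\<lambda>p. \<Sum>b\<in>?I. f (p b)) \<in> borel_measurable M"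
      unfolding M_def
      by (rule borel_measurable_sum)
        (rule measurable_PiM_component_rev[where M = "\<lambda>_. ?U" and f = f, OF _ f_meas])
    then show ?thesis unfolding E_def by measurable
  qed
  ultimately have "emeasure M {p \<in> space M. perm_test \<nu> n1 n2 B \<alpha> x p = 0} \<le> emeasure M E"
    by (rule emeasure_mono)
  also have "\<dots> = ennreal (measure M E)" by (simp add: emeasure_eq_measure)
  also have "measure M E \<le> exp (-2 * (real B * (\<alpha> / 2))\<^sup>2 / (\<Sum>b\<in>?I. (1 - 0)\<^sup>2))"
    unfolding E_def M_def m_def
    by (rule hoeffding_PiM_ge[where a = "\<lambda>_. 0" and b = "\<lambda>_. 1"])
      (use B \<alpha> PU f_meas in \<open>auto simp: f_def\<close>)
  also have "-2 * (real B * (\<alpha> / 2))\<^sup>2 / (\<Sum>b\<in>?I. (1 - 0)\<^sup>2) = - real B * \<alpha>\<^sup>2 / 2"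
    using B by (simp add: power2_eq_square field_simps)
  finally show ?thesis by (simp add: ennreal_leI)
qed

lemma perm_test_cong:
  assumes xy: "\<And>j. j \<in> {1..n1+n2} \<Longrightarrow> x j = y j"
    and p: "\<And>b. b \<in> {1..B} \<Longrightarrow> p b permutes {1..n1+n2}"
  shows "perm_test \<nu> n1 n2 B \<alpha> x p = perm_test \<nu> n1 n2 B \<alpha> y p"
proof -
  have "energy_stat \<nu> n1 n2 x = energy_stat \<nu> n1 n2 y"
    by (rule energy_stat_cong[OF xy])
  moreover have "permuted_energy_stat \<nu> n1 n2 x (p b) = permuted_energy_stat \<nu> n1 n2 y (p b)" if "b \<in> {1..B}" for b
    unfolding permuted_energy_stat_def
    by (rule energy_stat_cong) (metis xy p[OF that] permutes_in_image)
  ultimately show ?thesis unfolding perm_test_def by simp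
qed

text \<open>
  Conditioning on the data: on \<open>E\<close> the conditional acceptance probability is bounded by 1, off \<open>E\<close> by
  \<open>conditional_acceptance_le\<close>. If the acceptance set is not measurable, its measure is 0 by convention;
  otherwise all its sections are measurable and Fubini applies.
\<close>

lemma acceptance_prob_le_of_event:
  fixes P1 P2 PU :: "'h::{real_inner,second_countable_topology} measure"
  assumes P: "P1 \<in> borel_probs" "P2 \<in> borel_probs" "PU \<in> borel_probs"
    and B: "B \<ge> 1" and \<alpha>: "\<alpha> \<ge> 0"
    and E: "E \<in> sets (PiM {1..n1+n2} (\<lambda>j. if j \<le> n1 then sum_law P1 PU else sum_law P2 PU))"
    and small: "\<And>x. x \<in> space (PiM {1..n1+n2} (\<lambda>j. if j \<le> n1 then sum_law P1 PU else sum_law P2 PU)) \<Longrightarrow> x \<notin> E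
        \<Longrightarrow> energy_stat \<nu> n1 n2 x \<ge> t"
    and card: "\<And>x. real (card {p. p permutes {1..n1+n2} \<and> permuted_energy_stat \<nu> n1 n2 x p \<ge> t}) \<le> fact (n1 + n2) * (\<alpha> / 2)"
  shows "acceptance_prob \<nu> P1 P2 PU n1 n2 B \<alpha> \<le>
    emeasure (PiM {1..n1+n2} (\<lambda>j. if j \<le> n1 then sum_law P1 PU else sum_law P2 PU)) E
    + ennreal (exp (- real B * \<alpha>\<^sup>2 / 2))"
proof -
  let ?N = "{1..n1+n2}" and ?e = "ennreal (exp (- real B * \<alpha>\<^sup>2 / 2))"
  define Pj where "Pj j = (if j \<le> n1 then P1 else P2)" for j
  have Pj: "Pj j \<in> borel_probs" for j using P by (simp add: Pj_def)
  define M1 where "M1 = PiM ?N Pj"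
  define M2 where "M2 = PiM ?N (\<lambda>_. PU)"
  define M3 where "M3 = PiM {1..B} (\<lambda>b. uniform_count_measure {p. p permutes ?N})"
  define D where "D = PiM ?N (\<lambda>j. if j \<le> n1 then sum_law P1 PU else sum_law P2 PU)"
  have law: "sample_law P1 P2 PU n1 n2 B = M1 \<Otimes>\<^sub>M (M2 \<Otimes>\<^sub>M M3)"
    by (simp add: sample_law_def M1_def M2_def M3_def Pj_def[abs_def])
  have p1: "prob_space M1" and p2: "prob_space M2"
    unfolding M1_def M2_def using Pj P(3) by (auto intro!: prob_space_PiM simp: borel_probs_def)
  have p3: "prob_space M3"
    unfolding M3_def
    by (intro prob_space_PiM prob_space_uniform_count_measure)
      (auto simp: finite_permutations intro: exI[of _ id] permutes_id)
  interpret M1: prob_space M1 by (rule p1)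
  interpret M2: prob_space M2 by (rule p2)
  interpret M3: prob_space M3 by (rule p3)
  interpret M23: pair_prob_space M2 M3 ..
  let ?s = "\<lambda>(z, u). \<lambda>j\<in>?N. z j + u j"
  have D_distr: "distr (M1 \<Otimes>\<^sub>M M2) (PiM ?N (\<lambda>_. borel)) ?s = D"
    unfolding M1_def M2_def D_def distr_PiM_sum[OF finite_atLeastAtMost Pj P(3)]
    by (rule arg_cong[where f = "PiM ?N"]) (auto simp: Pj_def)
  have setsD: "sets D = sets (PiM ?N (\<lambda>_. borel :: 'h measure))"
    unfolding D_distr[symmetric] by simp
  then have spaceD: "space D = space (PiM ?N (\<lambda>_. borel :: 'h measure))"
    by (rule sets_eq_imp_space_eq)
  define A where "A = {(z, u, p) \<in> space (M1 \<Otimes>\<^sub>M (M2 \<Otimes>\<^sub>M M3)). perm_test \<nu> n1 n2 B \<alpha> (\<lambda>j. z j + u j) p = 0}"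
  show ?thesis
  proof (cases "A \<in> sets (M1 \<Otimes>\<^sub>M (M2 \<Otimes>\<^sub>M M3))")
    case False
    then have "emeasure (M1 \<Otimes>\<^sub>M (M2 \<Otimes>\<^sub>M M3)) A = 0"
      by (rule emeasure_notin_sets)
    then show ?thesis
      by (simp add: acceptance_prob_def law A_def)
  next
    case A: True
    have s_meas: "?s \<in> M1 \<Otimes>\<^sub>M M2 \<rightarrow>\<^sub>M PiM ?N (\<lambda>_. borel)"
    proof -
      have comp: "(\<lambda>x. fst x j + snd x j) \<in> borel_measurable (M1 \<Otimes>\<^sub>M M2)" if j: "j \<in> ?N" for j
      proof -
        have "(\<lambda>z. z j) \<in> M1 \<rightarrow>\<^sub>M Pj j" "(\<lambda>u. u j) \<in> M2 \<rightarrow>\<^sub>M PU"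
          unfolding M1_def M2_def by (rule measurable_component_singleton[OF j])+
        moreover have "sets (Pj j) = sets borel" "sets PU = sets borel"
          using Pj P(3) by (auto simp: borel_probs_def)
        ultimately have z: "(\<lambda>z. z j) \<in> borel_measurable M1" and u: "(\<lambda>u. u j) \<in> borel_measurable M2"
          by (simp_all cong: measurable_cong_sets)
        show ?thesis
          by (intro borel_measurable_add measurable_compose[OF measurable_fst z] measurable_compose[OF measurable_snd u])
      qed
      show ?thesis
        unfolding case_prod_unfold by (rule measurable_restrict) (rule comp)
    qed
    have E': "E \<in> sets (PiM ?N (\<lambda>_. borel))"
      using E setsD by (simp add: D_def)
    have ind_meas: "(\<lambda>x. indicator E (?s x) :: ennreal) \<in> borel_measurable (M1 \<Otimes>\<^sub>M M2)"
      by (rule measurable_compose[OF s_meas borel_measurable_indicator[OF E']])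
    have section_le: "emeasure M3 (Pair u -` (Pair z -` A)) \<le> indicator E (?s (z, u)) + ?e"
      if z: "z \<in> space M1" and u: "u \<in> space M2" for z u
    proof -
      let ?x = "\<lambda>j\<in>?N. z j + u j"
      have sec: "Pair u -` (Pair z -` A) = {p \<in> space M3. perm_test \<nu> n1 n2 B \<alpha> ?x p = 0}"
      proof -
        have "perm_test \<nu> n1 n2 B \<alpha> (\<lambda>j. z j + u j) p = perm_test \<nu> n1 n2 B \<alpha> ?x p" if "p \<in> space M3" for p
          by (rule perm_test_cong)
            (use that in \<open>auto simp: M3_def space_PiM PiE_iff space_uniform_count_measure\<close>)
        then show ?thesis
          using z u by (auto simp: A_def space_pair_measure)
      qed
      show ?thesis
      proof (cases "?x \<in> E")
        case True
        have "emeasure M3 (Pair u -` (Pair z -` A)) \<le> 1" by (rule M3.emeasure_le_1)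
        also have "\<dots> \<le> indicator E (?s (z, u)) + ?e"
          using True by (simp add: add_increasing2)
        finally show ?thesis .
      next
        case False
        have "?x \<in> space D" by (auto simp: spaceD space_PiM)
        then have "energy_stat \<nu> n1 n2 ?x \<ge> t"
          using False by (intro small) (simp_all add: D_def)
        then have "emeasure M3 {p \<in> space M3. perm_test \<nu> n1 n2 B \<alpha> ?x p = 0} \<le> ?e"
          unfolding M3_def by (rule conditional_acceptance_le[OF B \<alpha> _ card])
        then show ?thesis unfolding sec by (simp add: add_increasing)
      qed
    qed
    have "acceptance_prob \<nu> P1 P2 PU n1 n2 B \<alpha> = emeasure (M1 \<Otimes>\<^sub>M (M2 \<Otimes>\<^sub>M M3)) A"
      by (simp add: acceptance_prob_def law A_def)
    also have "\<dots> = (\<integral>\<^sup>+z. emeasure (M2 \<Otimes>\<^sub>M M3) (Pair z -` A) \<partial>M1)"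
      by (rule M23.emeasure_pair_measure_alt[OF A])
    also have "\<dots> = (\<integral>\<^sup>+z. \<integral>\<^sup>+u. emeasure M3 (Pair u -` (Pair z -` A)) \<partial>M2 \<partial>M1)"
      by (intro nn_integral_cong M3.emeasure_pair_measure_alt sets_Pair1[OF A])
    also have "\<dots> \<le> (\<integral>\<^sup>+z. \<integral>\<^sup>+u. indicator E (?s (z, u)) + ?e \<partial>M2 \<partial>M1)"
      by (intro nn_integral_mono section_le)
    also have "\<dots> = (\<integral>\<^sup>+x. indicator E (?s x) + ?e \<partial>(M1 \<Otimes>\<^sub>M M2))"
      by (rule M2.nn_integral_fst[where f = "\<lambda>x. indicator E (?s x) + ?e"]) (intro borel_measurable_add ind_meas borel_measurable_const)
    also have "\<dots> = (\<integral>\<^sup>+x. indicator E (?s x) \<partial>(M1 \<Otimes>\<^sub>M M2)) + (\<integral>\<^sup>+x. ?e \<partial>(M1 \<Otimes>\<^sub>M M2))"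
      by (rule nn_integral_add[OF ind_meas]) simp
    also have "(\<integral>\<^sup>+x. ?e \<partial>(M1 \<Otimes>\<^sub>M M2)) = ?e"
      using prob_space.emeasure_space_1[OF prob_space_pair[OF p1 p2]] by simp
    also have "(\<integral>\<^sup>+x. indicator E (?s x) \<partial>(M1 \<Otimes>\<^sub>M M2)) = (\<integral>\<^sup>+x. indicator E x \<partial>D)"
      unfolding D_distr[symmetric]
      by (rule nn_integral_distr[OF s_meas, symmetric])
        (simp only: measurable_distr_eq1, rule borel_measurable_indicator[OF E'])
    also have "\<dots> = emeasure D E"
      using E by (intro nn_integral_indicator) (simp add: D_def)
    finally show ?thesis by (simp add: D_def)
  qed
qed

section \<open>Gaussian moments and separation under contamination\<close>

text \<open>
  Partial sums of the squared coefficients are bounded by the squared norm (Bessel). They come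
  arbitrarily close to it, because the expansion is the best approximation and the finite linear
  combinations are dense.
\<close>

lemma parseval_tendsto:
  fixes e :: "nat \<Rightarrow> 'h::real_inner"
  assumes "orthonormal_basis e"
  shows "(\<lambda>n. \<Sum>i<n. (w \<bullet> e i)\<^sup>2) \<longlonglongrightarrow> (norm w)\<^sup>2"
proof -
  have ort: "e i \<bullet> e j = of_bool (i = j)" for i j
    using assms by (auto simp: orthonormal_basis_def)
  have dense: "closure (span (range e)) = UNIV"
    using assms by (auto simp: orthonormal_basis_def)
  have best: "(norm (w - (\<Sum>i<n. c i *\<^sub>R e i)))\<^sup>2 = ((norm w)\<^sup>2 - (\<Sum>i<n. (w \<bullet> e i)\<^sup>2)) + (\<Sum>i<n. (w \<bullet> e i - c i)\<^sup>2)" for n c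
  proof -
    have "(\<Sum>i<n. c i *\<^sub>R e i) \<bullet> (\<Sum>i<n. c i *\<^sub>R e i) = (\<Sum>i<n. (c i)\<^sup>2)"
      by (simp add: inner_sum_left inner_sum_right ort of_bool_def sum.delta if_distrib power2_eq_square cong: if_cong)
    moreover have "w \<bullet> (\<Sum>i<n. c i *\<^sub>R e i) = (\<Sum>i<n. c i * (w \<bullet> e i))"
      by (simp add: inner_sum_right)
    ultimately have "(norm (w - (\<Sum>i<n. c i *\<^sub>R e i)))\<^sup>2
        = (norm w)\<^sup>2 - 2 * (\<Sum>i<n. c i * (w \<bullet> e i)) + (\<Sum>i<n. (c i)\<^sup>2)"
      by (simp add: power2_norm_eq_inner inner_diff_left inner_diff_right inner_commute)
    also have "\<dots> = ((norm w)\<^sup>2 - (\<Sum>i<n. (w \<bullet> e i)\<^sup>2)) + (\<Sum>i<n. (w \<bullet> e i)\<^sup>2 - 2 * (c i * (w \<bullet> e i)) + (c i)\<^sup>2)"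
      by (simp add: sum.distrib sum_subtractf sum_distrib_left)
    also have "(\<Sum>i<n. (w \<bullet> e i)\<^sup>2 - 2 * (c i * (w \<bullet> e i)) + (c i)\<^sup>2) = (\<Sum>i<n. (w \<bullet> e i - c i)\<^sup>2)"
      by (intro sum.cong refl) (simp add: power2_diff)
    finally show ?thesis .
  qed
  have upper: "(\<Sum>i<n. (w \<bullet> e i)\<^sup>2) \<le> (norm w)\<^sup>2" for n
    using best[where n = n and c = "\<lambda>i. w \<bullet> e i"] zero_le_power2[of "norm (w - (\<Sum>i<n. (w \<bullet> e i) *\<^sub>R e i))"]
    by simp
  have rep: "\<exists>n c. v = (\<Sum>i<n. c i *\<^sub>R e i)" if "v \<in> span (range e)" for v
    using that
  proof (induction rule: span_induct_alt)
    case base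
    show ?case by (rule exI[of _ 0]) simp
  next
    case (step r x y)
    then obtain k n c where x: "x = e k" and y: "y = (\<Sum>i<n. c i *\<^sub>R e i)" by auto
    define m where "m = max n (Suc k)"
    have "y = (\<Sum>i<m. (if i < n then c i else 0) *\<^sub>R e i)"
      unfolding y by (rule sum.mono_neutral_cong_left) (auto simp: m_def)
    moreover have "r *\<^sub>R x = (\<Sum>i<m. (if i = k then r else 0) *\<^sub>R e i)"
      by (simp add: x if_distrib[of "\<lambda>t. t *\<^sub>R _"] m_def less_max_iff_disj cong: if_cong)
    ultimately have "r *\<^sub>R x + y = (\<Sum>i<m. ((if i = k then r else 0) + (if i < n then c i else 0)) *\<^sub>R e i)"
      by (simp add: sum.distrib scaleR_add_left)
    then show ?case by (intro exI[of _ m] exI)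
  qed
  show ?thesis
  proof (rule LIMSEQ_I)
    fix r :: real assume r: "r > 0"
    have "w \<in> closure (span (range e))" using dense by simp
    then obtain v where v: "v \<in> span (range e)" "dist v w < sqrt r"
      using r unfolding closure_approachable by (meson real_sqrt_gt_zero)
    obtain n c where vn: "v = (\<Sum>i<n. c i *\<^sub>R e i)" using rep[OF v(1)] by blast
    have "(norm w)\<^sup>2 - (\<Sum>i<n. (w \<bullet> e i)\<^sup>2) \<le> (norm (w - v))\<^sup>2"
      unfolding vn best by (simp add: sum_nonneg)
    also have "\<dots> < (sqrt r)\<^sup>2"
      using v(2) by (intro power_strict_mono) (simp_all add: dist_norm norm_minus_commute)
    also have "\<dots> = r" using r by simp
    finally have lower: "(norm w)\<^sup>2 - r < (\<Sum>i<n. (w \<bullet> e i)\<^sup>2)" by simp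
    have "norm ((\<Sum>i<m. (w \<bullet> e i)\<^sup>2) - (norm w)\<^sup>2) < r" if "m \<ge> n" for m
    proof -
      have "(\<Sum>i<n. (w \<bullet> e i)\<^sup>2) \<le> (\<Sum>i<m. (w \<bullet> e i)\<^sup>2)"
        using that by (intro sum_mono2) auto
      then show ?thesis using lower upper[of m] r by (simp add: abs_less_iff)
    qed
    then show "\<exists>no. \<forall>n\<ge>no. norm ((\<Sum>i<n. (w \<bullet> e i)\<^sup>2) - (norm w)\<^sup>2) < r" by blast
  qed
qed

text \<open>
  A marginal with positive variance is not a point mass. Mean and covariance then identify it as the
  centred normal law with variance \<open>C x \<bullet> x\<close>.
\<close>

lemma gaussian_coordinate_moment:
  fixes \<nu> :: "'h::{real_inner,second_countable_topology} measure"
  assumes \<nu>: "gaussian_measure \<nu>" "is_mean \<nu> 0" "is_covariance_operator \<nu> C"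
    and pos: "C x \<bullet> x > 0"
  shows "(\<integral>\<^sup>+w. ennreal ((w \<bullet> x) ^ (2 * k)) \<partial>\<nu>)
    = ennreal (fact (2 * k) / (2 ^ k * fact k) * (C x \<bullet> x) ^ k)"
proof -
  have [measurable_cong]: "sets \<nu> = sets borel" and "prob_space \<nu>"
    using \<nu> by (auto simp: gaussian_measure_def borel_probs_def)
  then interpret prob_space \<nu> by simp
  have [measurable]: "(\<lambda>z. z \<bullet> x) \<in> borel_measurable borel"
    by (intro borel_measurable_continuous_onI continuous_intros)
  let ?N = "distr \<nu> borel (\<lambda>z. z \<bullet> x)"
  have mean0: "(LINT z|\<nu>. z \<bullet> x) = 0"
    using \<nu>(2) by (simp add: is_mean_def)
  then have var: "C x \<bullet> x = (LINT z|\<nu>. (z \<bullet> x)\<^sup>2)"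
    using \<nu>(3) by (simp add: is_covariance_operator_def power2_eq_square)
  have m0: "(LINT t|?N. t) = 0" using mean0 by (simp add: integral_distr)
  have v0: "(LINT t|?N. t\<^sup>2) = C x \<bullet> x" using var by (simp add: integral_distr)
  have "gaussian_on_line ?N" using \<nu>(1) by (simp add: gaussian_measure_def)
  then consider (point) m where "?N = return borel m"
    | (normal) m \<sigma> where "\<sigma> > 0" "?N = density lborel (normal_density m \<sigma>)"
    by (auto simp: gaussian_on_line_def)
  then show ?thesis
  proof cases
    case point
    then have "m = 0" "m\<^sup>2 = C x \<bullet> x"
      using m0 v0 by (simp_all add: integral_return)
    with pos show ?thesis by simp
  next
    case normal
    have "m = 0"
      using m0 normal by (simp add: integral_density integral_normal_moment_nz_1)
    then have "\<sigma>\<^sup>2 = C x \<bullet> x"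
      using v0 normal integral_normal_moment_even[of \<sigma> 0 1] by (simp add: integral_density fact_numeral)
    have "(\<integral>\<^sup>+w. ennreal ((w \<bullet> x) ^ (2 * k)) \<partial>\<nu>) = (\<integral>\<^sup>+t. ennreal (t ^ (2 * k)) \<partial>?N)"
      by (simp add: nn_integral_distr)
    also have "\<dots> = (\<integral>\<^sup>+t. ennreal (normal_density 0 \<sigma> t * (t - 0) ^ (2 * k)) \<partial>lborel)"
      unfolding normal(2) \<open>m = 0\<close> by (subst nn_integral_density) (auto simp: ennreal_mult intro!: nn_integral_cong)
    also have "\<dots> = ennreal (fact (2 * k) / ((2 / \<sigma>\<^sup>2) ^ k * fact k))"
    proof -
      have "(\<integral>\<^sup>+t. ennreal (normal_density 0 \<sigma> t * (t - 0) ^ (2 * k)) \<partial>lborel)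
          = ennreal (LINT t|lborel. normal_density 0 \<sigma> t * (t - 0) ^ (2 * k))"
        by (rule nn_integral_eq_integral[OF integrable_normal_moment[OF normal(1)]]) simp
      then show ?thesis
        by (simp only: integral_normal_moment_even[OF normal(1)])
    qed
    also have "fact (2 * k) / ((2 / \<sigma>\<^sup>2) ^ k * fact k) = fact (2 * k) / (2 ^ k * fact k) * (C x \<bullet> x) ^ k"
      using normal(1) unfolding \<open>\<sigma>\<^sup>2 = C x \<bullet> x\<close>[symmetric] by (simp add: power_divide field_simps)
    finally show ?thesis .
  qed
qed

text \<open>
  Jensen's inequality for \<open>\<lambda>u. u ^ Suc k\<close> with weights \<open>l i / (\<Sum>i\<in>I. l i)\<close> at the points
  \<open>y i * (\<Sum>i\<in>I. l i) / l i\<close>.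
\<close>

lemma weighted_power_sum_le:
  fixes y l :: "'i \<Rightarrow> real"
  assumes "finite I" "\<And>i. i \<in> I \<Longrightarrow> l i > 0" "\<And>i. i \<in> I \<Longrightarrow> y i \<ge> 0"
  shows "(\<Sum>i\<in>I. y i) ^ Suc k \<le> (\<Sum>i\<in>I. l i) ^ k * (\<Sum>i\<in>I. y i ^ Suc k / l i ^ k)"
proof (cases "I = {}")
  case False
  define L where "L = (\<Sum>i\<in>I. l i)"
  have L: "L > 0" using False assms by (auto simp: L_def intro: sum_pos)
  have "convex_on {0..} (\<lambda>x::real. x ^ Suc k)"
    by (cases "even (Suc k)") (auto intro: convex_on_subset[OF convex_power_even] convex_power_odd simp del: power_Suc)
  then have "(\<Sum>i\<in>I. (l i / L) *\<^sub>R (y i * L / l i)) ^ Suc k \<le> (\<Sum>i\<in>I. (l i / L) * (y i * L / l i) ^ Suc k)"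
    using assms L False
    by (intro convex_on_sum[where C = "{0..}"]) (auto simp: sum_divide_distrib[symmetric] L_def[symmetric] less_imp_le)
  also have "(\<Sum>i\<in>I. (l i / L) *\<^sub>R (y i * L / l i)) = (\<Sum>i\<in>I. y i)"
    using assms L by (intro sum.cong refl) (auto simp: less_imp_neq[symmetric])
  also have "(\<Sum>i\<in>I. (l i / L) * (y i * L / l i) ^ Suc k) = (\<Sum>i\<in>I. L ^ k * (y i ^ Suc k / l i ^ k))"
  proof (intro sum.cong refl)
    fix i assume "i \<in> I"
    then have "l i > 0" using assms by auto
    then show "(l i / L) * (y i * L / l i) ^ Suc k = L ^ k * (y i ^ Suc k / l i ^ k)"
      using L by (simp add: field_simps power_mult_distrib power_divide)
  qed
  finally show ?thesis by (simp add: L_def sum_distrib_left)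
qed (simp)

text \<open>
  The squared norm is \<open>\<Sum>i. (w \<bullet> e i)\<^sup>2\<close>. Weighting the coordinates by their variances \<open>l i\<close> in
  \<open>weighted_power_sum_le\<close> reduces the moment to moments of single coordinates. This
  works for every orthonormal basis, whatever the joint law of the coordinates. Fatou's lemma passes
  to the limit.
\<close>

lemma gaussian_norm_moment_le:
  fixes \<nu> :: "'h::{real_inner,second_countable_topology} measure"
  assumes \<nu>: "\<nu> \<in> V_G c"
  shows "(\<integral>\<^sup>+w. ennreal (norm w ^ (2 * Suc k)) \<partial>\<nu>)
    \<le> ennreal (c ^ Suc k * (fact (2 * Suc k) / (2 ^ Suc k * fact (Suc k))))"
proof -
  obtain C t where g: "gaussian_measure \<nu>" "is_mean \<nu> 0" "is_covariance_operator \<nu> C"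
    and pd: "strictly_positive_definite C" and tr: "has_trace C t" "t \<le> c"
    using \<nu> by (auto simp: V_G_def)
  obtain e where e: "orthonormal_basis e" and sums: "(\<lambda>i. C (e i) \<bullet> e i) sums t"
    using tr by (auto simp: has_trace_def)
  have [measurable_cong]: "sets \<nu> = sets borel"
    using g by (auto simp: gaussian_measure_def borel_probs_def)
  have [measurable]: "(\<lambda>z. z \<bullet> e i) \<in> borel_measurable borel" for i
    by (intro borel_measurable_continuous_onI continuous_intros)
  let ?m = "fact (2 * Suc k) / (2 ^ Suc k * fact (Suc k)) :: real"
  define l where "l i = C (e i) \<bullet> e i" for i
  have l: "l i > 0" for i
  proof -
    have "e i \<bullet> e i = 1" using e by (simp add: orthonormal_basis_def)
    then have "e i \<noteq> 0" by auto
    then show ?thesis using pd by (simp add: l_def strictly_positive_definite_def)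
  qed
  have L: "(\<Sum>i<n. l i) \<le> c" for n
  proof -
    have "(\<Sum>i<n. l i) \<le> suminf l"
      using sums l by (intro sum_le_suminf) (auto simp: l_def[abs_def] sums_iff less_imp_le)
    then show ?thesis using sums tr by (auto simp: l_def[abs_def] sums_iff)
  qed
  have L0: "(\<Sum>i<n. l i) \<ge> 0" for n using l by (intro sum_nonneg) (auto simp: less_imp_le)
  have nn: "(w \<bullet> e i) ^ (2 * Suc k) \<ge> 0" for w i
    by (rule zero_le_even_power) simp
  have cancel: "y / b ^ k * (m * b ^ Suc k) = y * m * b" if "b > 0" for y m b :: real
    using that by simp
  have part: "(\<integral>\<^sup>+w. ennreal ((\<Sum>i<n. (w \<bullet> e i)\<^sup>2) ^ Suc k) \<partial>\<nu>) \<le> ennreal (c ^ Suc k * ?m)" for n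
  proof -
    have "(\<integral>\<^sup>+w. ennreal ((\<Sum>i<n. (w \<bullet> e i)\<^sup>2) ^ Suc k) \<partial>\<nu>)
        \<le> (\<integral>\<^sup>+w. ennreal ((\<Sum>i<n. l i) ^ k * (\<Sum>i<n. ((w \<bullet> e i)\<^sup>2) ^ Suc k / l i ^ k)) \<partial>\<nu>)"
      by (intro nn_integral_mono ennreal_leI weighted_power_sum_le) (use l in auto)
    also have "\<dots> = (\<integral>\<^sup>+w. (\<Sum>i<n. ennreal ((\<Sum>i<n. l i) ^ k / l i ^ k) * ennreal ((w \<bullet> e i) ^ (2 * Suc k))) \<partial>\<nu>)"
    proof (intro nn_integral_cong)
      fix w
      have "(\<Sum>i<n. l i) ^ k * (\<Sum>i<n. ((w \<bullet> e i)\<^sup>2) ^ Suc k / l i ^ k)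
          = (\<Sum>i<n. (\<Sum>i<n. l i) ^ k / l i ^ k * (w \<bullet> e i) ^ (2 * Suc k))"
        by (simp only: sum_distrib_left power_mult[symmetric] times_divide_eq_right times_divide_eq_left)
      also have "ennreal \<dots> = (\<Sum>i<n. ennreal ((\<Sum>i<n. l i) ^ k / l i ^ k * (w \<bullet> e i) ^ (2 * Suc k)))"
        by (intro sum_ennreal[symmetric] mult_nonneg_nonneg[OF divide_nonneg_nonneg nn] zero_le_power L0 less_imp_le[OF l])
      also have "\<dots> = (\<Sum>i<n. ennreal ((\<Sum>i<n. l i) ^ k / l i ^ k) * ennreal ((w \<bullet> e i) ^ (2 * Suc k)))"
        by (intro sum.cong refl ennreal_mult[OF divide_nonneg_nonneg nn] zero_le_power L0 less_imp_le[OF l])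
      finally show "ennreal ((\<Sum>i<n. l i) ^ k * (\<Sum>i<n. ((w \<bullet> e i)\<^sup>2) ^ Suc k / l i ^ k))
        = (\<Sum>i<n. ennreal ((\<Sum>i<n. l i) ^ k / l i ^ k) * ennreal ((w \<bullet> e i) ^ (2 * Suc k)))" .
    qed
    also have "\<dots> = (\<Sum>i<n. ennreal ((\<Sum>i<n. l i) ^ k / l i ^ k) * (\<integral>\<^sup>+w. ennreal ((w \<bullet> e i) ^ (2 * Suc k)) \<partial>\<nu>))"
      by (subst nn_integral_sum) (auto intro!: sum.cong nn_integral_cmult simp del: power_Suc)
    also have "\<dots> = (\<Sum>i<n. ennreal ((\<Sum>i<n. l i) ^ k * ?m * l i))"
    proof (intro sum.cong refl)
      fix i
      have "(\<integral>\<^sup>+w. ennreal ((w \<bullet> e i) ^ (2 * Suc k)) \<partial>\<nu>) = ennreal (?m * l i ^ Suc k)"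
        using gaussian_coordinate_moment[OF g, of "e i" "Suc k"] l[of i] by (simp only: l_def)
      then have "ennreal ((\<Sum>i<n. l i) ^ k / l i ^ k) * (\<integral>\<^sup>+w. ennreal ((w \<bullet> e i) ^ (2 * Suc k)) \<partial>\<nu>)
         = ennreal ((\<Sum>i<n. l i) ^ k / l i ^ k * (?m * l i ^ Suc k))"
        using l[of i] L0[of n] by (simp only:) (intro ennreal_mult[symmetric]; simp add: less_imp_le)
      also have "(\<Sum>i<n. l i) ^ k / l i ^ k * (?m * l i ^ Suc k) = (\<Sum>i<n. l i) ^ k * ?m * l i"
        by (rule cancel[OF l])
      finally show "ennreal ((\<Sum>i<n. l i) ^ k / l i ^ k) * (\<integral>\<^sup>+w. ennreal ((w \<bullet> e i) ^ (2 * Suc k)) \<partial>\<nu>)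
         = ennreal ((\<Sum>i<n. l i) ^ k * ?m * l i)" .
    qed
    also have "\<dots> = ennreal (\<Sum>i<n. (\<Sum>i<n. l i) ^ k * ?m * l i)"
      using l L0 by (intro sum_ennreal mult_nonneg_nonneg) (auto simp: less_imp_le)
    also have "(\<Sum>i<n. (\<Sum>i<n. l i) ^ k * ?m * l i) = (\<Sum>i<n. l i) ^ Suc k * ?m"
      unfolding sum_distrib_left[symmetric] by (simp only: power_Suc mult_ac)
    also have "\<dots> \<le> c ^ Suc k * ?m"
      using L L0 by (intro mult_right_mono power_mono) auto
    finally show ?thesis by (simp add: ennreal_leI)
  qed
  have "(\<integral>\<^sup>+w. ennreal (norm w ^ (2 * Suc k)) \<partial>\<nu>)
      = (\<integral>\<^sup>+w. liminf (\<lambda>n. ennreal ((\<Sum>i<n. (w \<bullet> e i)\<^sup>2) ^ Suc k)) \<partial>\<nu>)"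
  proof (intro nn_integral_cong)
    fix w
    have "(\<lambda>n. ennreal ((\<Sum>i<n. (w \<bullet> e i)\<^sup>2) ^ Suc k)) \<longlonglongrightarrow> ennreal (((norm w)\<^sup>2) ^ Suc k)"
      by (intro tendsto_ennrealI tendsto_power parseval_tendsto e)
    then show "ennreal (norm w ^ (2 * Suc k)) = liminf (\<lambda>n. ennreal ((\<Sum>i<n. (w \<bullet> e i)\<^sup>2) ^ Suc k))"
      by (simp only: power_mult lim_imp_Liminf[OF sequentially_bot])
  qed
  also have "\<dots> \<le> liminf (\<lambda>n. \<integral>\<^sup>+w. ennreal ((\<Sum>i<n. (w \<bullet> e i)\<^sup>2) ^ Suc k) \<partial>\<nu>)"
    by (intro nn_integral_liminf) measurable
  also have "\<dots> \<le> ennreal (c ^ Suc k * ?m)"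
    by (intro Liminf_le always_eventually allI part) simp
  finally show ?thesis .
qed

lemma V_G_borel_probs: "\<nu> \<in> V_G c \<Longrightarrow> \<nu> \<in> borel_probs"
  by (simp add: V_G_def gaussian_measure_def)

lemma one_plus_power_le: "(1 + r) ^ m \<le> 2 ^ m * (1 + r ^ m)" if "r \<ge> 0" for r :: real
proof (cases "r \<le> 1")
  case True
  then have "(1 + r) ^ m \<le> 2 ^ m" using that by (intro power_mono) auto
  also have "\<dots> \<le> 2 ^ m * (1 + r ^ m)" using that by simp
  finally show ?thesis .
next
  case False
  then have "(1 + r) ^ m \<le> (2 * r) ^ m" using that by (intro power_mono) auto
  also have "\<dots> \<le> 2 ^ m * (1 + r ^ m)" by (simp add: power_mult_distrib)
  finally show ?thesis .
qed

text \<open>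
  The exponent \<open>2 * s\<close> is dominated by an even integer, and the bound of the even moment depends on \<open>\<nu>\<close>
  only through \<open>c\<close>.
\<close>

lemma V_G_polynomial_moment:
  fixes c s :: real
  assumes "c > 0"
  shows "\<exists>C>0. \<forall>\<nu>\<in>(V_G c :: 'h::{real_inner,second_countable_topology} measure set).
    (\<integral>\<^sup>+w. ennreal ((1 + norm w) powr (2 * s)) \<partial>\<nu>) \<le> ennreal C"
proof -
  \<comment> \<open>\<open>Suc k\<close> rather than \<open>k\<close>, so that the moment bound applies also when \<open>k = 0\<close>\<close>
  define k where "k = nat \<lceil>s\<rceil>"
  define m where "m = 2 * Suc k"
  define A where "A = c ^ Suc k * (fact (2 * Suc k) / (2 ^ Suc k * fact (Suc k)))"
  have A: "A > 0" using assms by (simp add: A_def)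
  have pt: "(1 + norm w) powr (2 * s) \<le> 2 ^ m * (1 + norm w ^ m)" for w :: 'h
  proof -
    have "s \<le> real k" unfolding k_def by linarith
    then have "(1 + norm w) powr (2 * s) \<le> (1 + norm w) powr (real m)"
      by (intro powr_mono) (auto simp: m_def)
    also have "\<dots> = (1 + norm w) ^ m"
      by (rule powr_realpow) (simp add: add_pos_nonneg)
    also have "\<dots> \<le> 2 ^ m * (1 + norm w ^ m)" by (rule one_plus_power_le) simp
    finally show ?thesis .
  qed
  have "(\<integral>\<^sup>+w. ennreal ((1 + norm w) powr (2 * s)) \<partial>\<nu>) \<le> ennreal (2 ^ m * (1 + A))"
    if \<nu>: "\<nu> \<in> (V_G c :: 'h measure set)" for \<nu>
  proof -
    have [measurable_cong]: "sets \<nu> = sets borel" and "prob_space \<nu>"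
      using V_G_borel_probs[OF \<nu>] by (auto simp: borel_probs_def)
    then interpret prob_space \<nu> by simp
    have "(\<integral>\<^sup>+w. ennreal ((1 + norm w) powr (2 * s)) \<partial>\<nu>) \<le> (\<integral>\<^sup>+w. ennreal (2 ^ m) * (1 + ennreal (norm w ^ m)) \<partial>\<nu>)"
    proof (rule nn_integral_mono)
      fix w :: 'h
      have "ennreal ((1 + norm w) powr (2 * s)) \<le> ennreal (2 ^ m * (1 + norm w ^ m))"
        by (rule ennreal_leI[OF pt])
      also have "\<dots> = ennreal (2 ^ m) * (1 + ennreal (norm w ^ m))"
        by (simp add: ennreal_mult ennreal_plus)
      finally show "ennreal ((1 + norm w) powr (2 * s)) \<le> ennreal (2 ^ m) * (1 + ennreal (norm w ^ m))" .
    qed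
    also have "\<dots> = ennreal (2 ^ m) * (1 + (\<integral>\<^sup>+w. ennreal (norm w ^ m) \<partial>\<nu>))"
      by (simp add: nn_integral_cmult nn_integral_add emeasure_space_1)
    also have "\<dots> \<le> ennreal (2 ^ m) * (1 + ennreal A)"
      using gaussian_norm_moment_le[OF \<nu>, of k] unfolding A_def m_def
      by (intro mult_left_mono add_left_mono) auto
    also have "\<dots> = ennreal (2 ^ m * (1 + A))"
      using A by (simp add: ennreal_mult ennreal_plus)
    finally show ?thesis .
  qed
  moreover have "2 ^ m * (1 + A) > 0" using A by simp
  ultimately show ?thesis by blast
qed

text \<open>
  Cauchy-Schwarz for \<open>|\<phi>1 - \<phi>2| \<le> (|\<phi>1 - \<phi>2| * |\<phi>U|) * ((1 + norm w) powr s / cU)\<close>, which is the decay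
  condition on the error law.
\<close>

lemma contaminated_separation:
  fixes \<nu> P1 P2 PU :: "'h::{real_inner,second_countable_topology} measure"
  assumes \<nu>: "\<nu> \<in> borel_probs" and P: "P1 \<in> borel_probs" "P2 \<in> borel_probs"
    and PU: "PU \<in> F_U cU s" and cU: "cU > 0" and C: "C > 0"
    and w: "(\<integral>\<^sup>+w. ennreal ((1 + norm w) powr (2 * s)) \<partial>\<nu>) \<le> ennreal C"
  shows "(LINT w|\<nu>. cmod (char_functional P1 w - char_functional P2 w))\<^sup>2
    \<le> (LINT w|\<nu>. (cmod (char_functional (sum_law P1 PU) w - char_functional (sum_law P2 PU) w))\<^sup>2) * (C / cU\<^sup>2)"
proof -
  have PUb: "PU \<in> borel_probs" and PUw: "cU * (1 + norm w) powr (-s) \<le> cmod (char_functional PU w)" for w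
    using PU by (auto simp: F_U_def)
  have [measurable_cong]: "sets \<nu> = sets borel" and "prob_space \<nu>"
    using \<nu> by (auto simp: borel_probs_def)
  then interpret prob_space \<nu> by simp
  note [measurable] = char_functional_measurable[OF P(1)] char_functional_measurable[OF P(2)]
    char_functional_measurable[OF PUb]
  define d where "d w = cmod (char_functional P1 w - char_functional P2 w)" for w
  define D where "D w = d w * cmod (char_functional PU w)" for w
  define q where "q w = (1 + norm w) powr s / cU" for w :: 'h
  have [measurable]: "d \<in> borel_measurable borel" "D \<in> borel_measurable borel" "q \<in> borel_measurable borel"
    unfolding D_def d_def q_def by measurable
  have D_eq: "cmod (char_functional (sum_law P1 PU) w - char_functional (sum_law P2 PU) w) = D w" for w
    unfolding char_functional_sum_law[OF P(1) PUb] char_functional_sum_law[OF P(2) PUb]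
      left_diff_distrib[symmetric] norm_mult D_def d_def ..
  have d0: "d w \<ge> 0" and D0: "D w \<ge> 0" and q0: "q w \<ge> 0" for w
    using cU by (auto simp: d_def D_def q_def)
  have d2: "d w \<le> 2" for w
    using norm_triangle_ineq4[of "char_functional P1 w" "char_functional P2 w"]
      norm_char_functional_le[OF P(1), of w] norm_char_functional_le[OF P(2), of w]
    by (simp add: d_def)
  have D2: "D w \<le> 2" for w
    using mult_mono[OF d2 norm_char_functional_le[OF PUb, of w], of w] d0[of w] by (simp add: D_def)
  have int_d: "integrable \<nu> d"
    by (rule integrable_const_bound[where B = 2]) (use d0 d2 in auto)
  have int_D: "integrable \<nu> (\<lambda>w. (D w)\<^sup>2)"
    by (rule integrable_const_bound[where B = "2\<^sup>2"]) (use power_mono[OF D2 D0, of _ 2] in auto)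
  have dDq: "d w \<le> D w * q w" for w
  proof -
    have "1 = (cU * (1 + norm w) powr (-s)) * q w"
      using cU by (simp add: q_def powr_minus field_simps add_nonneg_eq_0_iff)
    also have "\<dots> \<le> cmod (char_functional PU w) * q w"
      by (rule mult_right_mono[OF PUw q0])
    finally have "d w * 1 \<le> d w * (cmod (char_functional PU w) * q w)"
      using d0 by (rule mult_left_mono)
    then show ?thesis by (simp add: D_def mult.assoc)
  qed
  have "ennreal ((LINT w|\<nu>. d w)\<^sup>2) = (ennreal (LINT w|\<nu>. d w))\<^sup>2"
    using d0 by (simp add: ennreal_power)
  also have "ennreal (LINT w|\<nu>. d w) = (\<integral>\<^sup>+w. ennreal (d w) \<partial>\<nu>)"
    using d0 by (intro nn_integral_eq_integral[symmetric] int_d) auto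
  also have "(\<integral>\<^sup>+w. ennreal (d w) \<partial>\<nu>)\<^sup>2 \<le> (\<integral>\<^sup>+w. ennreal (D w) * ennreal (q w) \<partial>\<nu>)\<^sup>2"
    using dDq by (intro power_mono nn_integral_mono) (auto simp: ennreal_mult[OF D0 q0, symmetric] intro: ennreal_leI)
  also have "\<dots> \<le> (\<integral>\<^sup>+w. (ennreal (D w))\<^sup>2 \<partial>\<nu>) * (\<integral>\<^sup>+w. (ennreal (q w))\<^sup>2 \<partial>\<nu>)"
    by (rule Cauchy_Schwarz_nn_integral) measurable
  also have "(\<integral>\<^sup>+w. (ennreal (D w))\<^sup>2 \<partial>\<nu>) = ennreal (LINT w|\<nu>. (D w)\<^sup>2)"
    using D0 by (subst nn_integral_eq_integral[OF int_D, symmetric]) (auto simp: ennreal_power)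
  also have "(\<integral>\<^sup>+w. (ennreal (q w))\<^sup>2 \<partial>\<nu>) \<le> ennreal (C / cU\<^sup>2)"
  proof -
    have "(\<integral>\<^sup>+w. (ennreal (q w))\<^sup>2 \<partial>\<nu>) = (\<integral>\<^sup>+w. ennreal ((1 + norm w) powr (2 * s)) * ennreal (1 / cU\<^sup>2) \<partial>\<nu>)"
    proof (intro nn_integral_cong)
      fix w
      have "(q w)\<^sup>2 = (1 + norm w) powr (2 * s) * (1 / cU\<^sup>2)"
        unfolding mult_2 powr_add by (simp add: q_def power_divide power2_eq_square)
      then show "(ennreal (q w))\<^sup>2 = ennreal ((1 + norm w) powr (2 * s)) * ennreal (1 / cU\<^sup>2)"
        by (simp only: ennreal_power[OF q0]) (rule ennreal_mult, auto)
    qed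
    also have "\<dots> = (\<integral>\<^sup>+w. ennreal ((1 + norm w) powr (2 * s)) \<partial>\<nu>) * ennreal (1 / cU\<^sup>2)"
      by (rule nn_integral_multc) measurable
    also have "\<dots> \<le> ennreal C * ennreal (1 / cU\<^sup>2)"
      by (intro mult_right_mono w) simp
    also have "\<dots> = ennreal (C / cU\<^sup>2)"
      using C by (simp add: ennreal_mult[symmetric])
    finally show ?thesis .
  qed
  finally have "ennreal ((LINT w|\<nu>. d w)\<^sup>2) \<le> ennreal (LINT w|\<nu>. (D w)\<^sup>2) * ennreal (C / cU\<^sup>2)"
    by (simp add: mult_left_mono)
  then have "ennreal ((LINT w|\<nu>. d w)\<^sup>2) \<le> ennreal ((LINT w|\<nu>. (D w)\<^sup>2) * (C / cU\<^sup>2))"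
    using C by (subst ennreal_mult) auto
  then have "(LINT w|\<nu>. d w)\<^sup>2 \<le> (LINT w|\<nu>. (D w)\<^sup>2) * (C / cU\<^sup>2)"
    using C by (subst (asm) ennreal_le_iff) auto
  then show ?thesis by (simp only: D_eq d_def)
qed

section \<open>The separation rate\<close>

text \<open>
  One of the two copies of \<open>L\<close> in the exponent yields the factor \<open>x\<close>, the other the factor \<open>1 / 2\<close>.
\<close>

lemma exp_neg_le_half:
  assumes "(L::real) \<ge> ln (1 / x)" "x > 0" "L \<ge> 1" "y \<ge> 2 * L"
  shows "exp (- y) \<le> x / 2"
proof -
  have "exp (- y) \<le> exp (- (ln (1 / x)) - 1)" using assms by simp
  also have "\<dots> = x * exp (- 1)" using assms by (simp add: exp_diff ln_div exp_minus divide_inverse)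
  also have "\<dots> \<le> x * (1 / 2)"
  proof (rule mult_left_mono)
    have "exp (1::real) \<ge> 2" using exp_ge_add_one_self[of 1] by simp
    then show "exp (- 1) \<le> (1 / 2 :: real)" by (simp add: exp_minus field_simps)
  qed (use assms in simp)
  finally show ?thesis by simp
qed

text \<open>
  With \<open>T = K * L / sqrt N\<close> the threshold is \<open>34 * T\<close>. It splits into \<open>2 * T\<close> for the permutation mean
  and \<open>32 * T\<close> for the deviation of the permuted statistic. A further \<open>2 * (4 * T)\<close> covers the deviation of the
  linearized statistic, which explains the 42. The multiples of \<open>T\<close> are chosen so that both exponents
  are at least \<open>2 * L\<close>.
\<close>

lemma acceptance_prob_le:
  fixes \<nu> P1 P2 PU :: "'h::{real_inner,second_countable_topology} measure"
  assumes n: "n1 \<ge> 1" "n2 \<ge> 1"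
    and \<alpha>: "0 < \<alpha>" "\<alpha> < 1" and \<beta>: "0 < \<beta>" "\<beta> < 1 / exp 1"
    and B: "real B \<ge> 2 * \<alpha> powr (-2) * ln (6 / \<beta>)"
    and K: "K > 0" "(real (n1 + n2))\<^sup>2 / (real n1 * real n2) \<le> K"
    and \<nu>: "\<nu> \<in> borel_probs" and P: "P1 \<in> borel_probs" "P2 \<in> borel_probs" "PU \<in> borel_probs"
    and sep: "42 * K * (ln (1 / \<alpha>) + ln (1 / \<beta>)) * real (n1 + n2) powr (-1/2)
      \<le> (LINT w|\<nu>. (cmod (char_functional (sum_law P1 PU) w - char_functional (sum_law P2 PU) w))\<^sup>2)"
  shows "acceptance_prob \<nu> P1 P2 PU n1 n2 B \<alpha> \<le> ennreal \<beta>"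
proof -
  define L where "L = ln (1 / \<alpha>) + ln (1 / \<beta>)"
  define N where "N = real (n1 + n2)"
  define r where "r = N / (real n1 * real n2)"
  define T where "T = K * L / sqrt N"
  have N: "N \<ge> 1" using n by (simp add: N_def)
  have r0: "r > 0" using n by (simp add: r_def N_def)
  have rN: "r * N \<le> K" using K(2) by (simp add: r_def N_def power2_eq_square)
  have L\<alpha>: "ln (1 / \<alpha>) \<ge> 0" using \<alpha> by simp
  have L\<beta>: "ln (1 / \<beta>) \<ge> 1"
  proof -
    have "1 = ln (exp 1 :: real)" by simp
    also have "\<dots> \<le> ln (1 / \<beta>)" using \<beta> by (intro ln_mono) (simp_all add: field_simps)
    finally show ?thesis .
  qed
  have L: "L \<ge> 1" using L\<alpha> L\<beta> by (simp add: L_def)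
  have LL: "L\<^sup>2 \<ge> L" using L by (simp add: power2_eq_square)
  have "K \<ge> 1"
  proof -
    have "real n1 * real n2 \<le> N\<^sup>2" by (simp add: N_def power2_eq_square algebra_simps)
    then have "1 \<le> N\<^sup>2 / (real n1 * real n2)" using n by simp
    then show ?thesis using K(2) by (simp add: N_def)
  qed
  have T0: "T \<ge> 0" using K L N by (simp add: T_def)
  have T2: "T\<^sup>2 * N = K\<^sup>2 * L\<^sup>2" using N by (simp add: T_def power_divide power_mult_distrib)
  have rT: "r \<le> T"
  proof -
    have "sqrt N \<le> N" using N by (simp add: real_le_lsqrt power2_eq_square)
    then have "r * sqrt N \<le> r * N" using r0 by simp
    also have "\<dots> \<le> K * 1" using rN by simp
    also have "\<dots> \<le> K * L" using K(1) by (intro mult_left_mono L) simp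
    finally show ?thesis using N by (simp add: T_def field_simps)
  qed
  have sep': "34 * T \<le> (LINT w|\<nu>. (cmod (char_functional (sum_law P1 PU) w - char_functional (sum_law P2 PU) w))\<^sup>2) - 2 * (4 * T)"
  proof -
    have "N powr (-1/2) = 1 / sqrt N"
      using N by (simp add: powr_minus_divide powr_half_sqrt)
    then have "42 * K * L * N powr (-1/2) = 42 * T" by (simp add: T_def)
    then show ?thesis using sep by (simp add: L_def N_def)
  qed
  let ?D = "PiM {1..n1+n2} (\<lambda>j. if j \<le> n1 then sum_law P1 PU else sum_law P2 PU)"
  obtain E where E: "E \<in> sets ?D" "{x \<in> space ?D. energy_stat \<nu> n1 n2 x < 34 * T} \<subseteq> E"
    "measure ?D E \<le> exp (- (4 * T)\<^sup>2 / (8 * r))"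
    using energy_stat_lower_tail[OF n \<nu> sum_law_borel_probs[OF P(1,3)] sum_law_borel_probs[OF P(2,3)] _ sep'] T0
    unfolding r_def N_def by auto
  have "measure ?D E \<le> \<beta> / 2"
  proof (rule order.trans[OF E(3)])
    have "2 * L \<le> (4 * T)\<^sup>2 / (8 * r)"
    proof -
      have "2 * L * (8 * r) * N = 16 * L * (r * N)" by simp
      also have "\<dots> \<le> 16 * L * K" using rN L by simp
      also have "\<dots> \<le> 16 * L\<^sup>2 * K\<^sup>2"
        using LL \<open>K \<ge> 1\<close> L by (intro mult_mono) (auto simp: power2_eq_square)
      also have "\<dots> = (4 * T)\<^sup>2 * N" using T2 by (simp add: power_mult_distrib)
      finally have "2 * L * (8 * r) \<le> (4 * T)\<^sup>2" using N by simp
      then show ?thesis using r0 by (simp add: le_divide_eq)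
    qed
    then have "exp (- ((4 * T)\<^sup>2 / (8 * r))) \<le> \<beta> / 2"
      using L L\<alpha> \<beta> by (intro exp_neg_le_half[of \<beta> L]) (simp_all add: L_def)
    then show "exp (- (4 * T)\<^sup>2 / (8 * r)) \<le> \<beta> / 2" by simp
  qed
  moreover have "prob_space ?D"
    using sum_law_borel_probs[OF P(1,3)] sum_law_borel_probs[OF P(2,3)]
    by (intro prob_space_PiM) (auto simp: borel_probs_def)
  ultimately have E_le: "emeasure ?D E \<le> ennreal (\<beta> / 2)"
    by (simp add: finite_measure.emeasure_eq_measure prob_space.finite_measure ennreal_leI)
  have ln6: "ln (6 / \<beta>) > 0"
    using \<beta> by (intro ln_gt_zero) (smt (verit) divide_less_eq_1_pos exp_ge_add_one_self less_divide_eq_1_pos)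
  have a2: "\<alpha> powr (-2) = 1 / \<alpha>\<^sup>2" using \<alpha> by (simp add: powr_minus_divide powr_numeral)
  have Ba: "real B * \<alpha>\<^sup>2 / 2 \<ge> ln (6 / \<beta>)" using B \<alpha> unfolding a2 by (simp add: field_simps)
  have B1: "B \<ge> 1"
  proof -
    have "real B * \<alpha>\<^sup>2 / 2 > 0" using Ba ln6 by linarith
    then show ?thesis by (cases B) auto
  qed
  have card: "real (card {p. p permutes {1..n1+n2} \<and> permuted_energy_stat \<nu> n1 n2 x p \<ge> 34 * T}) \<le> fact (n1 + n2) * (\<alpha> / 2)" for x
  proof -
    have "real (card {p. p permutes {1..n1+n2} \<and> permuted_energy_stat \<nu> n1 n2 x p \<ge> 34 * T})
        \<le> fact (n1 + n2) * exp (- (32 * T)\<^sup>2 / (2 * (16 * r)\<^sup>2 * N))"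
    proof -
      have "34 * T \<ge> 2 * (real (n1 + n2) / (real n1 * real n2)) + 32 * T"
        using rT unfolding r_def N_def by linarith
      with T0 show ?thesis
        unfolding r_def N_def by (intro permuted_energy_stat_tail[OF n \<nu>]) simp_all
    qed
    also have "\<dots> \<le> fact (n1 + n2) * (\<alpha> / 2)"
    proof (rule mult_left_mono)
      have "2 * L \<le> (32 * T)\<^sup>2 / (2 * (16 * r)\<^sup>2 * N)"
      proof -
        have "2 * L * (2 * (16 * r)\<^sup>2 * N) * N = 1024 * L * (r * N)\<^sup>2"
          by (simp add: power_mult_distrib power2_eq_square)
        also have "\<dots> \<le> 1024 * L\<^sup>2 * K\<^sup>2"
          using LL rN r0 N L by (intro mult_mono power_mono) auto
        also have "\<dots> = (32 * T)\<^sup>2 * N" using T2 by (simp add: power_mult_distrib)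
        finally have "2 * L * (2 * (16 * r)\<^sup>2 * N) \<le> (32 * T)\<^sup>2" using N by simp
        then show ?thesis using r0 N by (simp add: le_divide_eq mult_ac)
      qed
      then have "exp (- ((32 * T)\<^sup>2 / (2 * (16 * r)\<^sup>2 * N))) \<le> \<alpha> / 2"
        using L L\<beta> \<alpha> by (intro exp_neg_le_half[of \<alpha> L]) (simp_all add: L_def)
      then show "exp (- (32 * T)\<^sup>2 / (2 * (16 * r)\<^sup>2 * N)) \<le> \<alpha> / 2" by simp
    qed simp
    finally show ?thesis .
  qed
  have "acceptance_prob \<nu> P1 P2 PU n1 n2 B \<alpha> \<le> emeasure ?D E + ennreal (exp (- real B * \<alpha>\<^sup>2 / 2))"
  proof (rule acceptance_prob_le_of_event[OF P B1 _ E(1) _ card])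
    show "energy_stat \<nu> n1 n2 x \<ge> 34 * T" if "x \<in> space ?D" "x \<notin> E" for x
      using that E(2) by force
  qed (use \<alpha> in simp)
  also have "\<dots> \<le> ennreal (\<beta> / 2) + ennreal (\<beta> / 2)"
  proof (rule add_mono[OF E_le ennreal_leI])
    have "exp (- real B * \<alpha>\<^sup>2 / 2) \<le> exp (- ln (6 / \<beta>))" using Ba by simp
    also have "\<dots> = \<beta> / 6" using \<beta> by (simp add: exp_minus)
    finally show "exp (- real B * \<alpha>\<^sup>2 / 2) \<le> \<beta> / 2" using \<beta> by simp
  qed
  also have "\<dots> = ennreal \<beta>" using \<beta> by (simp add: ennreal_plus[symmetric])
  finally show ?thesis .
qed

lemma sample_ratio_le:
  assumes "n1 \<ge> 1" "n2 \<ge> 1" "c1 > 0" "c1 \<le> real n1 / real n2" "real n1 / real n2 \<le> c2"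
  shows "(real (n1 + n2))\<^sup>2 / (real n1 * real n2) \<le> c2 + 2 + 1 / c1"
proof -
  have "(real (n1 + n2))\<^sup>2 / (real n1 * real n2) = real n1 / real n2 + 2 + 1 / (real n1 / real n2)"
    using assms by (simp add: field_simps power2_eq_square)
  moreover have "1 / (real n1 / real n2) \<le> 1 / c1"
    using assms by (intro divide_left_mono) auto
  ultimately show ?thesis using assms by simp
qed

theorem proposition4p10:
  fixes c cU s c1 c2 :: real
  assumes "infinite_dimensional TYPE('h::{real_inner, banach, second_countable_topology})"
    and "c > 0" and "cU > 0" and "s > 0" and "c1 > 0" and "c2 > 0"
  shows "\<exists>c0>0. \<forall>(\<alpha>::real) (\<beta>::real) (n1::nat) (n2::nat) (B::nat).
      0 < \<alpha> \<and> \<alpha> < 1 \<and> 0 < \<beta> \<and> \<beta> < 1 \<and> 0 < \<alpha> + \<beta> \<and> \<alpha> + \<beta> < 1 \<and>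
      n1 \<ge> 1 \<and> n2 \<ge> 1 \<and> c1 \<le> real n1 / real n2 \<and> real n1 / real n2 \<le> c2 \<and>
      \<beta> < 1 / exp 1 \<and> real B \<ge> 2 * \<alpha> powr (-2) * ln (6 / \<beta>) \<longrightarrow>
      separation_rate TYPE('h) c cU s \<alpha> \<beta> n1 n2 B
        \<le> ereal (c0 * real (n1 + n2) powr (-1/2) * (ln (1 / \<alpha>) + ln (1 / \<beta>)))"
proof -
  obtain C where C: "C > 0"
    and mom: "\<And>\<nu>. \<nu> \<in> (V_G c :: 'h measure set) \<Longrightarrow> (\<integral>\<^sup>+w. ennreal ((1 + norm w) powr (2 * s)) \<partial>\<nu>) \<le> ennreal C"
    using V_G_polynomial_moment[OF assms(2), of s] by blast
  define K where "K = c2 + 2 + 1 / c1"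
  have K: "K > 0" using assms by (simp add: K_def add_pos_pos)
  define c0 where "c0 = 42 * K * C / cU\<^sup>2"
  have c0: "c0 > 0" using K C assms by (simp add: c0_def)
  show ?thesis
  proof (intro exI[of _ c0] conjI c0 allI impI, elim conjE)
    fix \<alpha> \<beta> :: real and n1 n2 B :: nat
    assume \<alpha>: "0 < \<alpha>" "\<alpha> < 1" and \<beta>: "0 < \<beta>" "\<beta> < 1" "\<beta> < 1 / exp 1"
      and n: "n1 \<ge> 1" "n2 \<ge> 1" and ratio: "c1 \<le> real n1 / real n2" "real n1 / real n2 \<le> c2"
      and B: "real B \<ge> 2 * \<alpha> powr (-2) * ln (6 / \<beta>)"
    define L where "L = ln (1 / \<alpha>) + ln (1 / \<beta>)"
    define \<rho> where "\<rho> = c0 * real (n1 + n2) powr (-1/2) * L"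
    have L: "L > 0" using \<alpha> \<beta> by (simp add: L_def add_pos_pos)
    have \<rho>: "\<rho> > 0" using c0 L n by (simp add: \<rho>_def)
    have KN: "(real (n1 + n2))\<^sup>2 / (real n1 * real n2) \<le> K"
      unfolding K_def by (rule sample_ratio_le[OF n assms(5) ratio])
    have acc: "acceptance_prob \<nu> P1 P2 PU n1 n2 B \<alpha> \<le> ennreal \<beta>"
      if \<nu>: "\<nu> \<in> (V_G c :: 'h measure set)" and F: "(P1, P2) \<in> F1 \<nu> \<rho>" and PU: "PU \<in> F_U cU s" for \<nu> P1 P2 PU
    proof -
      have P: "P1 \<in> borel_probs" "P2 \<in> borel_probs"
        and far: "\<rho> \<le> (LINT w|\<nu>. cmod (char_functional P1 w - char_functional P2 w))\<^sup>2"
        using F by (auto simp: F1_def)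
      let ?\<Delta> = "LINT w|\<nu>. (cmod (char_functional (sum_law P1 PU) w - char_functional (sum_law P2 PU) w))\<^sup>2"
      have "\<rho> \<le> ?\<Delta> * (C / cU\<^sup>2)"
        using far contaminated_separation[OF V_G_borel_probs[OF \<nu>] P PU assms(3) C mom[OF \<nu>]]
        by (rule order.trans)
      moreover have "\<rho> = 42 * K * L * real (n1 + n2) powr (-1/2) * (C / cU\<^sup>2)"
        by (simp add: \<rho>_def c0_def)
      moreover have "C / cU\<^sup>2 > 0" using C assms(3) by simp
      ultimately have "42 * K * L * real (n1 + n2) powr (-1/2) \<le> ?\<Delta>"
        by (metis mult_le_cancel_right_pos)
      then show ?thesis
        using PU by (intro acceptance_prob_le[OF n \<alpha> \<beta>(1,3) B K KN V_G_borel_probs[OF \<nu>] P])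
          (auto simp: L_def F_U_def)
    qed
    have "(SUP \<nu> \<in> (V_G c :: 'h measure set). SUP ((P1, P2), PU) \<in> F1 \<nu> \<rho> \<times> F_U cU s.
        acceptance_prob \<nu> P1 P2 PU n1 n2 B \<alpha>) \<le> ennreal \<beta>"
      by (intro SUP_least) (use acc in auto)
    then have "separation_rate TYPE('h) c cU s \<alpha> \<beta> n1 n2 B \<le> ereal \<rho>"
      unfolding separation_rate_def using \<rho> by (intro Inf_lower imageI) simp
    then show "separation_rate TYPE('h) c cU s \<alpha> \<beta> n1 n2 B
        \<le> ereal (c0 * real (n1 + n2) powr (-1/2) * (ln (1 / \<alpha>) + ln (1 / \<beta>)))"
      by (simp add: \<rho>_def L_def)
  qed
qed

end
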